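(* The Noether symmetry group of the equation $\Delta_{H^1}u=0$ is generated by the group $G_f=\{T,R,\tilde X,\tilde Y\}$, where $$T=\frac{\partial}{\partial t},\quad R=y\frac{\partial}{\partial x}-x\frac{\partial}{\partial y},\quad \tilde X=\frac{\partial}{\partial x}-2y\frac{\partial}{\partial t},\quad \tilde Y=\frac{\partial}{\partial y}+2x\frac{\partial}{\partial t},$$ and by the symmetries $W_\beta=\beta(x,y,t)\frac{\partial}{\partial u}$, where $\beta$ satisfies $\Delta_{H^1}\beta=0$, and $$V_1=(xt-x^2y-y^3)\frac{\partial}{\partial x}+(yt+x^3+xy^2)\frac{\partial}{\partial y}+(t^2-(x^2+y^2)^2)\frac{\partial}{\partial t}-tu\frac{\partial}{\partial u},$$ $$V_2=(t-4xy)\frac{\partial}{\partial x}+(3x^2-y^2)\frac{\partial}{\partial y}-(2yt+2x^3+2xy^2)\frac{\partial}{\partial t}+2yu\frac{\partial}{\partial u},$$ $$V_3=(x^2-3y^2)\frac{\partial}{\partial x}+(t+4xy)\frac{\partial}{\partial y}+(2xt-2x^2y-2y^3)\frac{\partial}{\partial t}-2xu\frac{\partial}{\partial u}.$$ That is, a Lie point symmetry of this equation is a Noether symmetry if and only if it belongs to the Lie algebra (closed under linear combinations and Lie brackets) generated by $T,R,\tilde X,\tilde Y,V_1,V_2,V_3$ and all $W_\beta$ with $\Delta_{H^1}\beta=0$.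
   Context: Coordinates on $\mathbb{R}^3$ (the Heisenberg group $H^1$) are $(x^1,x^2,x^3)=(x,y,t)$, and $u=u(x,y,t)$ is a smooth real-valued function. The Kohn-Laplace operator is $$\Delta_{H^1}u=u_{xx}+u_{yy}+4(x^2+y^2)u_{tt}+4y\,u_{xt}-4x\,u_{yt}.$$ The equation $\Delta_{H^1}u=0$ is the Euler-Lagrange equation of the Lagrangian $$\mathcal{L}=\tfrac12u_x^2+\tfrac12u_y^2+2(x^2+y^2)u_t^2+2y\,u_xu_t-2x\,u_yu_t.$$ A Lie point symmetry is a vector field $S=\xi^i(x,y,t,u)\frac{\partial}{\partial x^i}+\eta(x,y,t,u)\frac{\partial}{\partial u}$ (sum over $i=1,2,3$) whose second prolongation annihilates $\Delta_{H^1}u$ whenever $\Delta_{H^1}u=0$. Its first prolongation is $S^{(1)}=S+\eta^{(1)}_i\frac{\partial}{\partial u_i}$, $\eta^{(1)}_i=D_i\eta-(D_i\xi^j)u_j$, where $D_i$ is the total derivative with respect to $x^i$ and $u_i=\partial u/\partial x^i$. A Lie point symmetry $S$ is a Noether symmetry if there exists $\varphi=(\varphi^1,\varphi^2,\varphi^3)$, with components functions of $x,y,t,u$ and derivatives of $u$, such that $S^{(1)}\mathcal{L}+\mathcal{L}\,D_i\xi^i=D_i\varphi^i$ identically. Symmetry groups are identified with the infinitesimal generators that generate them. By the known group classification, the Lie point symmetries of $\Delta_{H^1}u=0$ are the linear combinations of $T,R,\tilde X,\tilde Y,V_1,V_2,V_3$, $Z=x\frac{\partial}{\partial x}+y\frac{\partial}{\partial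 y}+2t\frac{\partial}{\partial t}$, $U=u\frac{\partial}{\partial u}$ and the $W_\beta$ with $\Delta_{H^1}\beta=0$. *)

theory Defs
  imports "HOL-Analysis.Analysis"
begin

primrec Ck :: "nat \<Rightarrow> ('a::euclidean_space \<Rightarrow> 'b::real_normed_vector) \<Rightarrow> bool" where
  "Ck 0 f \<longleftrightarrow> continuous_on UNIV f"
| "Ck (Suc k) f \<longleftrightarrow>
     (\<forall>x. f differentiable (at x)) \<and> (\<forall>b\<in>Basis. Ck k (\<lambda>x. frechet_derivative f (at x) b))"

definition smooth :: "('a::euclidean_space \<Rightarrow> 'b::real_normed_vector) \<Rightarrow> bool" where
  "smooth f \<longleftrightarrow> (\<forall>k. Ck k f)"

definition partial :: "3 \<Rightarrow> (real^3 \<Rightarrow> real) \<Rightarrow> real^3 \<Rightarrow> real" where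
  "partial i f p = frechet_derivative f (at p) (axis i 1)"

text \<open>Throughout, \<open>(x, y, t) = (p $ 1, p $ 2, p $ 3)\<close>.\<close>

definition kohn_laplace :: "(real^3 \<Rightarrow> real) \<Rightarrow> real^3 \<Rightarrow> real" where
  "kohn_laplace u p =
     partial 1 (partial 1 u) p + partial 2 (partial 2 u) p
     + 4 * ((p $ 1)\<^sup>2 + (p $ 2)\<^sup>2) * partial 3 (partial 3 u) p
     + 4 * (p $ 2) * partial 3 (partial 1 u) p - 4 * (p $ 1) * partial 3 (partial 2 u) p"

text \<open>
  \<open>Indep i\<close> is the independent variable \<open>x\<^sup>i\<close>. \<open>Deriv \<alpha>\<close> is the derivative of \<open>u\<close> with
  multi-index \<open>\<alpha>\<close>, so \<open>Deriv 0\<close> is \<open>u\<close> itself, \<open>u\<^sub>i\<close> is \<open>Deriv (axis i 1)\<close> and \<open>u\<^sub>i\<^sub>j\<close> is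
  \<open>Deriv (axis i 1 + axis j 1)\<close>; symmetry of mixed derivatives is built in. A point of the
  infinite jet space assigns a real number to every coordinate.
\<close>

datatype coord = Indep 3 | Deriv "nat^3"

type_synonym jet = "coord \<Rightarrow> real"

definition jet_x :: "3 \<Rightarrow> jet \<Rightarrow> real" where
  "jet_x i J = J (Indep i)"

definition jet_u :: "jet \<Rightarrow> real" where
  "jet_u J = J (Deriv 0)"

definition jet_u1 :: "3 \<Rightarrow> jet \<Rightarrow> real" where
  "jet_u1 i J = J (Deriv (axis i 1))"

definition jet_u2 :: "3 \<Rightarrow> 3 \<Rightarrow> jet \<Rightarrow> real" where
  "jet_u2 i j J = J (Deriv (axis i 1 + axis j 1))"

definition pd :: "coord \<Rightarrow> (jet \<Rightarrow> real) \<Rightarrow> jet \<Rightarrow> real" where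
  "pd c F J = deriv (\<lambda>s. F (J(c := s))) (J c)"

text \<open>Continuity below refers to the product topology on \<^typ>\<open>jet\<close>. For functions of finitely
  many coordinates, as required in \<open>differential_function\<close>, this is continuity in those
  coordinates, and \<open>jet_Ck\<close> is the usual \<open>C\<^sup>k\<close>.\<close>

primrec jet_Ck :: "nat \<Rightarrow> (jet \<Rightarrow> real) \<Rightarrow> bool" where
  "jet_Ck 0 F \<longleftrightarrow> continuous_on UNIV F"
| "jet_Ck (Suc k) F \<longleftrightarrow> continuous_on UNIV F \<and>
     (\<forall>c J. (\<lambda>s. F (J(c := s))) differentiable (at (J c))) \<and> (\<forall>c. jet_Ck k (pd c F))"

definition order_le :: "nat \<Rightarrow> (jet \<Rightarrow> real) \<Rightarrow> bool" where
  "order_le n F \<longleftrightarrow>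
     (\<forall>J J'. (\<forall>i. J (Indep i) = J' (Indep i)) \<longrightarrow>
             (\<forall>\<alpha>. (\<Sum>i\<in>UNIV. \<alpha> $ i) \<le> n \<longrightarrow> J (Deriv \<alpha>) = J' (Deriv \<alpha>)) \<longrightarrow> F J = F J')"

definition differential_function :: "(jet \<Rightarrow> real) \<Rightarrow> bool" where
  "differential_function F \<longleftrightarrow> (\<exists>n. order_le n F) \<and> (\<forall>k. jet_Ck k F)"

text \<open>The sum over all multi-indices is restricted to the nonzero terms, of which a function of
  finite order has only finitely many.\<close>

definition total_deriv :: "3 \<Rightarrow> (jet \<Rightarrow> real) \<Rightarrow> jet \<Rightarrow> real" where
  "total_deriv i F J =
     pd (Indep i) F J
     + (\<Sum>\<alpha> | pd (Deriv \<alpha>) F J \<noteq> 0. J (Deriv (\<alpha> + axis i 1)) * pd (Deriv \<alpha>) F J)"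

text \<open>The vector field \<open>\<xi>\<^sup>i \<partial>/\<partial>x\<^sup>i + \<eta> \<partial>/\<partial>u\<close> is the map \<open>(p, u) \<mapsto> (\<xi> (p, u), \<eta> (p, u))\<close>.\<close>

type_synonym vfield = "(real^3) \<times> real \<Rightarrow> (real^3) \<times> real"

definition jet_point :: "jet \<Rightarrow> (real^3) \<times> real" where
  "jet_point J = ((\<chi> i. jet_x i J), jet_u J)"

definition xi :: "vfield \<Rightarrow> 3 \<Rightarrow> jet \<Rightarrow> real" where
  "xi S i J = fst (S (jet_point J)) $ i"

definition eta :: "vfield \<Rightarrow> jet \<Rightarrow> real" where
  "eta S J = snd (S (jet_point J))"

definition eta1 :: "vfield \<Rightarrow> 3 \<Rightarrow> jet \<Rightarrow> real" where
  "eta1 S i J = total_deriv i (eta S) J - (\<Sum>j\<in>UNIV. total_deriv i (xi S j) J * jet_u1 j J)"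

definition eta2 :: "vfield \<Rightarrow> 3 \<Rightarrow> 3 \<Rightarrow> jet \<Rightarrow> real" where
  "eta2 S i j J =
     total_deriv j (eta1 S i) J - (\<Sum>k\<in>UNIV. total_deriv j (xi S k) J * jet_u2 i k J)"

definition prolong1 :: "vfield \<Rightarrow> (jet \<Rightarrow> real) \<Rightarrow> jet \<Rightarrow> real" where
  "prolong1 S F J =
     (\<Sum>i\<in>UNIV. xi S i J * pd (Indep i) F J)
     + eta S J * pd (Deriv 0) F J
     + (\<Sum>i\<in>UNIV. eta1 S i J * pd (Deriv (axis i 1)) F J)"

text \<open>Since \<open>u\<^sub>i\<^sub>j = u\<^sub>j\<^sub>i\<close> is a single coordinate, the second-order terms are summed over
  \<open>i \<le> j\<close>, i.e. over unordered pairs. (The linear order on the type \<open>3\<close> has \<open>3 = 0\<close> as its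
  least element, which is immaterial here because \<open>eta2\<close> is symmetric in \<open>i\<close> and \<open>j\<close>.)\<close>

definition prolong2 :: "vfield \<Rightarrow> (jet \<Rightarrow> real) \<Rightarrow> jet \<Rightarrow> real" where
  "prolong2 S F J =
     prolong1 S F J
     + (\<Sum>(i, j) | i \<le> j. eta2 S i j J * pd (Deriv (axis i 1 + axis j 1)) F J)"

definition kohn_laplace_jet :: "jet \<Rightarrow> real" where
  "kohn_laplace_jet J =
     jet_u2 1 1 J + jet_u2 2 2 J
     + 4 * ((jet_x 1 J)\<^sup>2 + (jet_x 2 J)\<^sup>2) * jet_u2 3 3 J
     + 4 * jet_x 2 J * jet_u2 1 3 J - 4 * jet_x 1 J * jet_u2 2 3 J"

definition lagrangian :: "jet \<Rightarrow> real" where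
  "lagrangian J =
     1/2 * (jet_u1 1 J)\<^sup>2 + 1/2 * (jet_u1 2 J)\<^sup>2
     + 2 * ((jet_x 1 J)\<^sup>2 + (jet_x 2 J)\<^sup>2) * (jet_u1 3 J)\<^sup>2
     + 2 * jet_x 2 J * jet_u1 1 J * jet_u1 3 J - 2 * jet_x 1 J * jet_u1 2 J * jet_u1 3 J"

definition lie_point_symmetry :: "vfield \<Rightarrow> bool" where
  "lie_point_symmetry S \<longleftrightarrow>
     smooth S \<and> (\<forall>J. kohn_laplace_jet J = 0 \<longrightarrow> prolong2 S kohn_laplace_jet J = 0)"

definition noether_symmetry :: "vfield \<Rightarrow> bool" where
  "noether_symmetry S \<longleftrightarrow>
     lie_point_symmetry S \<and>
     (\<exists>\<phi>::3 \<Rightarrow> jet \<Rightarrow> real. (\<forall>i. differential_function (\<phi> i)) \<and>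
        (\<forall>J. prolong1 S lagrangian J + lagrangian J * (\<Sum>i\<in>UNIV. total_deriv i (xi S i) J)
             = (\<Sum>i\<in>UNIV. total_deriv i (\<phi> i) J)))"

definition lie_bracket :: "vfield \<Rightarrow> vfield \<Rightarrow> vfield" where
  "lie_bracket A B = (\<lambda>z. frechet_derivative B (at z) (A z) - frechet_derivative A (at z) (B z))"

inductive_set lie_generated :: "vfield set \<Rightarrow> vfield set" for G :: "vfield set" where
  generator: "A \<in> G \<Longrightarrow> A \<in> lie_generated G"
| zero: "(\<lambda>z. 0) \<in> lie_generated G"
| add: "\<lbrakk>A \<in> lie_generated G; B \<in> lie_generated G\<rbrakk> \<Longrightarrow> (\<lambda>z. A z + B z) \<in> lie_generated G"
| scale: "A \<in> lie_generated G \<Longrightarrow> (\<lambda>z. c *\<^sub>R A z) \<in> lie_generated G"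
| bracket: "\<lbrakk>A \<in> lie_generated G; B \<in> lie_generated G\<rbrakk> \<Longrightarrow> lie_bracket A B \<in> lie_generated G"

definition vf_T :: vfield where
  "vf_T = (\<lambda>(p, u). (vector [0, 0, 1], 0))"

definition vf_R :: vfield where
  "vf_R = (\<lambda>(p, u). (vector [p $ 2, - (p $ 1), 0], 0))"

definition vf_X :: vfield where
  "vf_X = (\<lambda>(p, u). (vector [1, 0, - 2 * (p $ 2)], 0))"

definition vf_Y :: vfield where
  "vf_Y = (\<lambda>(p, u). (vector [0, 1, 2 * (p $ 1)], 0))"

definition vf_V1 :: vfield where
  "vf_V1 = (\<lambda>(p, u). let x = p $ 1; y = p $ 2; t = p $ 3 in
     (vector [x * t - x^2 * y - y^3, y * t + x^3 + x * y^2, t^2 - (x^2 + y^2)^2], - t * u))"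

definition vf_V2 :: vfield where
  "vf_V2 = (\<lambda>(p, u). let x = p $ 1; y = p $ 2; t = p $ 3 in
     (vector [t - 4 * x * y, 3 * x^2 - y^2, - (2 * y * t + 2 * x^3 + 2 * x * y^2)], 2 * y * u))"

definition vf_V3 :: vfield where
  "vf_V3 = (\<lambda>(p, u). let x = p $ 1; y = p $ 2; t = p $ 3 in
     (vector [x^2 - 3 * y^2, t + 4 * x * y, 2 * x * t - 2 * x^2 * y - 2 * y^3], - 2 * x * u))"

definition vf_W :: "(real^3 \<Rightarrow> real) \<Rightarrow> vfield" where
  "vf_W \<beta> = (\<lambda>(p, u). (0, \<beta> p))"

end

theory Submission
  imports Defs
begin

text \<open>
  Comparing the determining equations at suitable jets shows that a point symmetry has the form
  $\xi^i(x) \partial_i + (c(x) u + b(x)) \partial_u$ with $\Delta b = 0$. In the frame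
  $X = \partial_x + 2 y \partial_t$, $Y = \partial_y - 2 x \partial_t$, $[X, Y] = - 4 \partial_t$,
  the remaining equations say that $\xi$ is the contact field of
  $f = \xi^3 - 2 y \xi^1 + 2 x \xi^2$, that is $\xi^1 = - Y f / 4$ and $\xi^2 = X f / 4$, that
  $X^2 f = Y^2 f$ and $X Y f = - Y X f$, and that $c$ is determined by $f$ up to a constant $k$.
  With $h = f_t$ and $g = X^2 f$ one gets $X g = - 6 Y h$ and $Y g = 6 X h$, hence $g_t = 0$ from the
  commutator, and then $X h_t = Y h_t = 0$. So $h_t$ is constant, and $f$ is determined by eight
  values at the origin; the eight solutions are spanned by the contact fields of
  $T, R, \tilde X, \tilde Y, V_1, V_2, V_3$ and $Z$, where $[T, V_1] = Z - U$.
  For $k = 0$ the vector field is a Noether symmetry with potential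
  $\frac12 u^2 A \nabla c + u A \nabla b$, where $A$ is the symbol of $\Delta$. In general its
  Noether identity is off by $2 k \mathcal L$, which is not a divergence unless $k = 0$: on the jets
  of a function vanishing to high order on the boundary of the unit cube a divergence has
  integral $0$, whereas $\mathcal L$ is a sum of two squares that do not both vanish.
\<close>

section \<open>Smooth functions\<close>

text \<open>The function f is the value on the field of the contact form dt - 2 y dx + 2 x dy, which
  annihilates X and Y. The equations for \<open>\<xi> 1\<close> and \<open>\<xi> 2\<close> are
  conformality: X xi^1 = Y xi^2 and X xi^2 = - Y xi^1. With lambda = X xi^1, the squared horizontal
  gradient changes at rate - 2 lambda and the volume at rate 4 lambda, so the weight of u that
  balances the Lagrangian is c = - lambda, and k measures the departure from it. Hence Z - U passes
  where Z fails. As Z - U lies outside the linear span of the listed generators, the closure under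
  brackets is essential. The converse is shaped by \<phi> being allowed derivatives of u of any
  order: the Noether identity offers no fixed list of coefficients to compare. Integration sees
  \<phi> only through its boundary values. The price is a chain rule on an infinite jet space, where
  differentiability is given one coordinate at a time.\<close>

lemma CkI:
  assumes "\<And>x. (f has_derivative f' x) (at x)" "\<And>b. b \<in> Basis \<Longrightarrow> Ck k (\<lambda>x. f' x b)"
  shows "Ck (Suc k) f"
proof -
  have "frechet_derivative f (at x) = f' x" for x
    using frechet_derivative_at[OF assms(1)] by simp
  then show ?thesis using assms by (auto simp: differentiable_def)
qed

lemma CkD:
  assumes "Ck (Suc k) f"
  shows "(f has_derivative frechet_derivative f (at x)) (at x)"
    and "b \<in> Basis \<Longrightarrow> Ck k (\<lambda>x. frechet_derivative f (at x) b)"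
  using assms by (auto simp: frechet_derivative_works)

lemma Ck_Suc_imp_Ck: "Ck (Suc k) f \<Longrightarrow> Ck k f"
proof (induction k arbitrary: f)
  case 0
  then show ?case
    by (auto intro!: continuous_at_imp_continuous_on differentiable_imp_continuous_within)
next
  case (Suc k)
  then show ?case by auto
qed

lemma Ck_const: "Ck k (\<lambda>x. c)"
  by (induction k arbitrary: c) auto

lemma Ck_add: "Ck k f \<Longrightarrow> Ck k g \<Longrightarrow> Ck k (\<lambda>x. f x + g x)"
proof (induction k arbitrary: f g)
  case 0
  then show ?case by (auto intro: continuous_on_add)
next
  case (Suc k)
  show ?case
    by (rule CkI[OF has_derivative_add[OF CkD(1)[OF Suc.prems(1)] CkD(1)[OF Suc.prems(2)]]])
      (intro Suc.IH CkD(2)[OF Suc.prems(1)] CkD(2)[OF Suc.prems(2)])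
qed

lemma Ck_bounded_linear:
  assumes "bounded_linear L"
  shows "Ck k f \<Longrightarrow> Ck k (\<lambda>x. L (f x))"
proof (induction k arbitrary: f)
  case 0
  then show ?case using assms by (auto intro: bounded_linear.continuous_on)
next
  case (Suc k)
  show ?case
    by (rule CkI[OF bounded_linear.has_derivative[OF assms CkD(1)[OF Suc.prems]]])
      (intro Suc.IH CkD(2)[OF Suc.prems])
qed

lemma Ck_mult:
  fixes f g :: "'a::euclidean_space \<Rightarrow> real"
  shows "Ck k f \<Longrightarrow> Ck k g \<Longrightarrow> Ck k (\<lambda>x. f x * g x)"
proof (induction k arbitrary: f g)
  case 0
  then show ?case by (auto intro: continuous_on_mult)
next
  case (Suc k)
  note f = Suc.prems(1) and g = Suc.prems(2)
  show ?case
    by (rule CkI[OF has_derivative_mult[OF CkD(1)[OF f] CkD(1)[OF g]]])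
      (intro Ck_add Suc.IH CkD(2)[OF f] CkD(2)[OF g] Ck_Suc_imp_Ck[OF f] Ck_Suc_imp_Ck[OF g])
qed

lemma Ck_fst:
  fixes f :: "'a::euclidean_space \<Rightarrow> 'c::real_normed_vector"
  shows "Ck k f \<Longrightarrow> Ck k (\<lambda>z::'a \<times> 'b::euclidean_space. f (fst z))"
proof (induction k arbitrary: f)
  case 0
  then have "continuous_on UNIV (f \<circ> fst)"
    by (intro continuous_on_compose) (auto intro: continuous_on_subset continuous_on_fst)
  then show ?case by (simp add: o_def)
next
  case (Suc k)
  note f = Suc.prems
  show ?case
  proof (rule CkI)
    show "((\<lambda>z::'a \<times> 'b. f (fst z)) has_derivative (\<lambda>h. frechet_derivative f (at (fst z)) (fst h))) (at z)"
      for z :: "'a \<times> 'b"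
      using diff_chain_at[OF has_derivative_fst[OF has_derivative_ident] CkD(1)[OF f]]
      by (simp add: o_def)
    fix b :: "'a \<times> 'b" assume "b \<in> Basis"
    then have "fst b \<in> Basis \<or> fst b = 0" by (auto simp: Basis_prod_def)
    then show "Ck k (\<lambda>z::'a \<times> 'b. frechet_derivative f (at (fst z)) (fst b))"
    proof
      assume "fst b \<in> Basis"
      then show ?thesis by (rule Suc.IH[OF CkD(2)[OF f]])
    next
      assume b: "fst b = 0"
      have "frechet_derivative f (at x) 0 = 0" for x
        using linear_0[OF has_derivative_linear[OF CkD(1)[OF f]]] .
      then show ?thesis using b by (simp add: Ck_const)
    qed
  qed
qed

lemma Ck_slice:
  fixes f :: "'a::euclidean_space \<times> 'b::euclidean_space \<Rightarrow> 'c::real_normed_vector"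
  shows "Ck k f \<Longrightarrow> Ck k (\<lambda>p. f (p, v))"
proof (induction k arbitrary: f)
  case 0
  then have "continuous_on UNIV (f \<circ> (\<lambda>p. (p, v)))"
    by (intro continuous_on_compose) (auto intro: continuous_on_subset continuous_intros)
  then show ?case by (simp add: o_def)
next
  case (Suc k)
  note f = Suc.prems
  show ?case
  proof (rule CkI)
    show "((\<lambda>p. f (p, v)) has_derivative (\<lambda>h. frechet_derivative f (at (p, v)) (h, 0))) (at p)" for p
      using diff_chain_at[OF has_derivative_Pair[OF has_derivative_ident has_derivative_const] CkD(1)[OF f]]
      by (simp add: o_def)
    fix b :: 'a assume "b \<in> Basis"
    then have "(b, 0) \<in> (Basis :: ('a \<times> 'b) set)" by (auto simp: Basis_prod_def)
    from Suc.IH[OF CkD(2)[OF f this]]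
    show "Ck k (\<lambda>p. frechet_derivative f (at (p, v)) (b, 0))" .
  qed
qed

lemma smooth_const [simp, intro]: "smooth (\<lambda>x. c)"
  by (simp add: smooth_def Ck_const)

lemma smooth_add [simp, intro]: "smooth f \<Longrightarrow> smooth g \<Longrightarrow> smooth (\<lambda>x. f x + g x)"
  by (simp add: smooth_def Ck_add)

lemma smooth_bounded_linear: "bounded_linear L \<Longrightarrow> smooth f \<Longrightarrow> smooth (\<lambda>x. L (f x))"
  by (simp add: smooth_def Ck_bounded_linear)

lemma smooth_minus [simp, intro]: "smooth f \<Longrightarrow> smooth (\<lambda>x. - f x)"
  by (intro smooth_bounded_linear[where L = uminus] bounded_linear_minus bounded_linear_ident)

lemma smooth_diff [simp, intro]: "smooth f \<Longrightarrow> smooth g \<Longrightarrow> smooth (\<lambda>x. f x - g x)"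
  using smooth_add[of f "\<lambda>x. - g x"] by simp

lemma smooth_mult [simp, intro]:
  fixes f g :: "'a::euclidean_space \<Rightarrow> real"
  shows "smooth f \<Longrightarrow> smooth g \<Longrightarrow> smooth (\<lambda>x. f x * g x)"
  by (simp add: smooth_def Ck_mult)

lemma smooth_power [simp, intro]:
  fixes f :: "'a::euclidean_space \<Rightarrow> real"
  shows "smooth f \<Longrightarrow> smooth (\<lambda>x. f x ^ n)"
  by (induction n) auto

lemma smooth_divide [simp, intro]:
  fixes f :: "'a::euclidean_space \<Rightarrow> real"
  shows "smooth f \<Longrightarrow> smooth (\<lambda>x. f x / c)"
  using smooth_mult[of f "\<lambda>x. inverse c"] by (simp add: divide_inverse)

lemma smooth_fst [simp, intro]:
  fixes f :: "'a::euclidean_space \<Rightarrow> 'c::real_normed_vector"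
  shows "smooth f \<Longrightarrow> smooth (\<lambda>z::'a \<times> 'b::euclidean_space. f (fst z))"
  by (simp add: smooth_def Ck_fst)

lemma smooth_slice:
  fixes f :: "'a::euclidean_space \<times> 'b::euclidean_space \<Rightarrow> 'c::real_normed_vector"
  shows "smooth f \<Longrightarrow> smooth (\<lambda>p. f (p, v))"
  by (simp add: smooth_def Ck_slice)

lemma smooth_ident: "smooth (\<lambda>x::'a::euclidean_space. x)"
  unfolding smooth_def
proof
  fix k show "Ck k (\<lambda>x::'a. x)"
    by (cases k) (auto intro!: CkI has_derivative_ident Ck_const)
qed

lemma smooth_nth [simp, intro]: "smooth (\<lambda>p::real^'n. p $ i)"
  by (rule smooth_bounded_linear[OF bounded_linear_vec_nth smooth_ident])

lemma smooth_snd [simp, intro]: "smooth (\<lambda>z::'a::euclidean_space \<times> 'b::euclidean_space. snd z)"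
  by (rule smooth_bounded_linear[OF bounded_linear_snd smooth_ident])

lemma smooth_has_derivative:
  "smooth f \<Longrightarrow> (f has_derivative frechet_derivative f (at x)) (at x)"
  by (rule CkD(1)[of 0]) (simp add: smooth_def del: Ck.simps)

lemma smooth_continuous: "smooth f \<Longrightarrow> continuous_on UNIV f"
  unfolding smooth_def using Ck.simps(1) by blast

lemma smooth_frechet:
  "smooth f \<Longrightarrow> b \<in> Basis \<Longrightarrow> smooth (\<lambda>x. frechet_derivative f (at x) b)"
  by (simp add: smooth_def CkD(2) del: Ck.simps)

lemma smooth_line_deriv:
  assumes "smooth f"
  shows "((\<lambda>s. f (p + s *\<^sub>R a)) has_vector_derivative frechet_derivative f (at (p + s *\<^sub>R a)) a) (at s)"
proof -
  have "((\<lambda>s. p + s *\<^sub>R a) has_derivative (\<lambda>s. s *\<^sub>R a)) (at s)"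
    by (auto intro!: derivative_eq_intros)
  from diff_chain_at[OF this smooth_has_derivative[OF assms]]
  show ?thesis
    using linear_scale[OF has_derivative_linear[OF smooth_has_derivative[OF assms]]]
    by (simp add: has_vector_derivative_def o_def)
qed

text \<open>The second difference over a small square, evaluated by the mean value theorem in either
  order.\<close>

lemma smooth_frechet_commute:
  fixes f :: "'a::euclidean_space \<Rightarrow> real"
  assumes f: "smooth f" and a: "a \<in> Basis" and b: "b \<in> Basis"
  shows "frechet_derivative (\<lambda>x. frechet_derivative f (at x) a) (at p) b =
         frechet_derivative (\<lambda>x. frechet_derivative f (at x) b) (at p) a"
proof -
  define D where "D c f x = frechet_derivative f (at x) c" for c and f :: "'a \<Rightarrow> real" and x
  have sD: "smooth (D c f)" if "smooth f" "c \<in> Basis" for c f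
    using smooth_frechet[OF that] unfolding D_def .
  have line: "((\<lambda>s. f (p + s *\<^sub>R c)) has_real_derivative D c f (p + s *\<^sub>R c)) (at s)"
    if "smooth f" for f c p s
    using smooth_line_deriv[OF that, of p c s] unfolding D_def
    by (simp add: has_real_derivative_iff_has_vector_derivative)
  define R where "R a b h = f (p + h *\<^sub>R a + h *\<^sub>R b) - f (p + h *\<^sub>R a) - f (p + h *\<^sub>R b) + f p"
    for a b h
  have key: "((\<lambda>h. R a b h / h^2) \<longlongrightarrow> D b (D a f) p) (at_right 0)" if ab: "a \<in> Basis" "b \<in> Basis" for a b
  proof -
    have ex: "\<exists>\<xi> \<tau>. \<bar>\<xi>\<bar> \<le> h \<and> \<bar>\<tau>\<bar> \<le> h \<and> R a b h / h^2 = D b (D a f) (p + \<xi> *\<^sub>R a + \<tau> *\<^sub>R b)"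
      if h: "h > 0" for h
    proof -
      have "((\<lambda>s. f (p + h *\<^sub>R b + s *\<^sub>R a) - f (p + s *\<^sub>R a)) has_real_derivative
             D a f (p + h *\<^sub>R b + s *\<^sub>R a) - D a f (p + s *\<^sub>R a)) (at s)" for s
        by (intro DERIV_diff line f)
      from MVT2[OF h this] obtain \<xi> where \<xi>: "0 < \<xi>" "\<xi> < h" and
        "f (p + h *\<^sub>R b + h *\<^sub>R a) - f (p + h *\<^sub>R a) - (f (p + h *\<^sub>R b + 0 *\<^sub>R a) - f (p + 0 *\<^sub>R a)) =
         (h - 0) * (D a f (p + h *\<^sub>R b + \<xi> *\<^sub>R a) - D a f (p + \<xi> *\<^sub>R a))"
        by blast
      then have R: "R a b h = h * (D a f (p + \<xi> *\<^sub>R a + h *\<^sub>R b) - D a f (p + \<xi> *\<^sub>R a))"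
        by (simp add: R_def add_ac)
      have "((\<lambda>t. D a f (p + \<xi> *\<^sub>R a + t *\<^sub>R b)) has_real_derivative
             D b (D a f) (p + \<xi> *\<^sub>R a + t *\<^sub>R b)) (at t)" for t
        by (intro line sD f ab)
      from MVT2[OF h this] obtain \<tau> where \<tau>: "0 < \<tau>" "\<tau> < h" and
        "D a f (p + \<xi> *\<^sub>R a + h *\<^sub>R b) - D a f (p + \<xi> *\<^sub>R a + 0 *\<^sub>R b) =
         (h - 0) * D b (D a f) (p + \<xi> *\<^sub>R a + \<tau> *\<^sub>R b)"
        by blast
      with R have "R a b h = h * (h * D b (D a f) (p + \<xi> *\<^sub>R a + \<tau> *\<^sub>R b))" by simp
      then have "R a b h / h^2 = D b (D a f) (p + \<xi> *\<^sub>R a + \<tau> *\<^sub>R b)"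
        using h by (simp add: power2_eq_square)
      then show ?thesis using \<xi> \<tau> by (intro exI[of _ \<xi>] exI[of _ \<tau>]) simp
    qed
    then obtain \<xi> \<tau> where *: "\<And>h. h > 0 \<Longrightarrow> \<bar>\<xi> h\<bar> \<le> h \<and> \<bar>\<tau> h\<bar> \<le> h \<and>
        R a b h / h^2 = D b (D a f) (p + \<xi> h *\<^sub>R a + \<tau> h *\<^sub>R b)"
      by metis
    have lim: "(\<zeta> \<longlongrightarrow> 0) (at_right 0)" if "\<And>h. h > 0 \<Longrightarrow> \<bar>\<zeta> h\<bar> \<le> h" for \<zeta> :: "real \<Rightarrow> real"
      by (rule Lim_null_comparison[of _ "\<lambda>h. h"])
        (auto simp: that intro!: eventually_at_rightI[of 0 1] tendsto_ident_at)
    have "((\<lambda>h. p + \<xi> h *\<^sub>R a + \<tau> h *\<^sub>R b) \<longlongrightarrow> p + 0 *\<^sub>R a + 0 *\<^sub>R b) (at_right 0)"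
      using * by (intro tendsto_intros lim) auto
    then have "((\<lambda>h. p + \<xi> h *\<^sub>R a + \<tau> h *\<^sub>R b) \<longlongrightarrow> p) (at_right 0)" by simp
    moreover have "isCont (D b (D a f)) p"
      using smooth_continuous[OF sD[OF sD[OF f ab(1)] ab(2)]] by (simp add: continuous_on_eq_continuous_at)
    ultimately have "((\<lambda>h. D b (D a f) (p + \<xi> h *\<^sub>R a + \<tau> h *\<^sub>R b)) \<longlongrightarrow> D b (D a f) p) (at_right 0)"
      by (rule isCont_tendsto_compose[rotated])
    then show ?thesis
      by (rule Lim_transform_eventually) (use * in \<open>auto intro!: eventually_at_rightI[of 0 1]\<close>)
  qed
  have "R a b = R b a" by (simp add: R_def fun_eq_iff add_ac)
  then have "D b (D a f) p = D a (D b f) p"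
    using tendsto_unique[OF _ key[OF a b]] key[OF b a] by simp
  then show ?thesis by (simp add: D_def[abs_def])
qed

section \<open>Partial derivatives\<close>

lemma smooth_partial [simp, intro]: "smooth f \<Longrightarrow> smooth (partial i f)"
  unfolding partial_def[abs_def] by (rule smooth_frechet) (auto simp: axis_in_Basis_iff)

lemma partial_commute: "smooth f \<Longrightarrow> partial i (partial j f) = partial j (partial i f)"
  unfolding partial_def[abs_def]
  by (intro ext smooth_frechet_commute) (auto simp: axis_in_Basis_iff)

lemma partialI: "(f has_derivative f') (at p) \<Longrightarrow> partial i f p = f' (axis i 1)"
  by (simp add: partial_def frechet_derivative_at[symmetric])

lemma partial_const [simp]: "partial i (\<lambda>p. c) = (\<lambda>p. 0)"
  by (simp add: fun_eq_iff partial_def)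

lemma partial_nth [simp]: "partial i (\<lambda>p. p $ j) = (\<lambda>p. if i = j then 1 else 0)"
  by (rule ext, subst partialI[OF bounded_linear_imp_has_derivative[OF bounded_linear_vec_nth]])
    (auto simp: axis_def)

lemma partial_add [simp]:
  "smooth f \<Longrightarrow> smooth g \<Longrightarrow> partial i (\<lambda>p. f p + g p) = (\<lambda>p. partial i f p + partial i g p)"
  by (rule ext, subst partialI[OF has_derivative_add[OF smooth_has_derivative smooth_has_derivative]])
    (auto simp: partial_def)

lemma partial_diff [simp]:
  "smooth f \<Longrightarrow> smooth g \<Longrightarrow> partial i (\<lambda>p. f p - g p) = (\<lambda>p. partial i f p - partial i g p)"
  by (rule ext, subst partialI[OF has_derivative_diff[OF smooth_has_derivative smooth_has_derivative]])
    (auto simp: partial_def)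

lemma partial_minus [simp]: "smooth f \<Longrightarrow> partial i (\<lambda>p. - f p) = (\<lambda>p. - partial i f p)"
  by (rule ext, subst partialI[OF has_derivative_minus[OF smooth_has_derivative]])
    (auto simp: partial_def)

lemma partial_mult [simp]:
  "smooth f \<Longrightarrow> smooth g \<Longrightarrow>
    partial i (\<lambda>p. f p * g p) = (\<lambda>p. partial i f p * g p + f p * partial i g p)"
  by (rule ext, subst partialI[OF has_derivative_mult[OF smooth_has_derivative smooth_has_derivative]])
    (auto simp: partial_def)

lemma partial_power [simp]:
  "smooth f \<Longrightarrow> partial i (\<lambda>p. f p ^ n) = (\<lambda>p. of_nat n * f p ^ (n - 1) * partial i f p)"
proof (induction n)
  case (Suc n)
  then show ?case by (cases n) (auto simp: fun_eq_iff algebra_simps)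
qed simp

lemma frechet_partial:
  assumes "smooth f"
  shows "frechet_derivative f (at p) v = (\<Sum>i\<in>UNIV. v $ i * partial i f p)"
proof -
  interpret linear "frechet_derivative f (at p)"
    by (rule has_derivative_linear[OF smooth_has_derivative[OF assms]])
  have "v = (\<Sum>i\<in>UNIV. v $ i *\<^sub>R axis i 1)"
    by (simp add: vec_eq_iff axis_def if_distrib cong: if_cong)
  then have "frechet_derivative f (at p) v =
      frechet_derivative f (at p) (\<Sum>i\<in>UNIV. v $ i *\<^sub>R axis i 1)" by simp
  also have "\<dots> = (\<Sum>i\<in>UNIV. v $ i * partial i f p)"
    unfolding sum scale by (simp add: partial_def)
  finally show ?thesis .
qed

lemma smooth_const_if_partials_zero:
  assumes "smooth f" "\<And>i p. partial i f p = 0"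
  shows "f p = f q"
proof (rule has_derivative_zero_unique[where s = UNIV and f = f])
  fix x assume "x \<in> (UNIV :: (real^3) set)"
  have "frechet_derivative f (at x) = (\<lambda>h. 0)"
    using frechet_partial[OF assms(1)] assms(2) by (auto simp: fun_eq_iff)
  then show "(f has_derivative (\<lambda>h. 0)) (at x)"
    using smooth_has_derivative[OF assms(1), of x] by simp
qed auto

section \<open>Calculus on jet space\<close>

text \<open>Finiteness is included because \<open>total_deriv\<close> sums over the nonzero
  partials, and a sum over an infinite set would silently be 0. This class suffices for linearity
  and the product rule of \<open>total_deriv\<close>; the chain rule needs the stronger
  \<open>jet_C1\<close>.\<close>

definition jet_differentiable :: "(jet \<Rightarrow> real) \<Rightarrow> bool" where
  "jet_differentiable F \<longleftrightarrow>
     (\<forall>J. (\<forall>c. (\<lambda>s. F (J(c := s))) differentiable (at (J c))) \<and> finite {\<alpha>. pd (Deriv \<alpha>) F J \<noteq> 0})"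

lemma jet_differentiableD:
  assumes "jet_differentiable F"
  shows "((\<lambda>s. F (J(c := s))) has_real_derivative pd c F J) (at (J c))"
    and "finite {\<alpha>. pd (Deriv \<alpha>) F J \<noteq> 0}"
proof -
  have "(\<lambda>s. F (J(c := s))) field_differentiable (at (J c))"
    using assms real_differentiableE field_differentiable_def
    unfolding jet_differentiable_def by metis
  then show "((\<lambda>s. F (J(c := s))) has_real_derivative pd c F J) (at (J c))"
    by (simp add: pd_def field_differentiable_derivI)
  show "finite {\<alpha>. pd (Deriv \<alpha>) F J \<noteq> 0}"
    using assms by (simp add: jet_differentiable_def)
qed

lemma jet_differentiableI:
  assumes "\<And>J c. ((\<lambda>s. F (J(c := s))) has_real_derivative g c J) (at (J c))"
    and "\<And>J. finite {\<alpha>. g (Deriv \<alpha>) J \<noteq> 0}"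
  shows "jet_differentiable F \<and> (\<forall>c. pd c F = g c)"
proof -
  have *: "pd c F = g c" for c
    using DERIV_imp_deriv[OF assms(1)] by (simp add: pd_def[abs_def])
  show ?thesis
    unfolding jet_differentiable_def * using assms real_differentiable_def by auto
qed

text \<open>The index set inside \<open>total_deriv\<close> varies with the function and the jet.
  Passing to a common finite superset lets the sums of several functions be combined term by
  term.\<close>

lemma total_deriv_eq:
  assumes "finite A" "\<And>\<alpha>. \<alpha> \<notin> A \<Longrightarrow> pd (Deriv \<alpha>) F J = 0"
  shows "total_deriv i F J =
    pd (Indep i) F J + (\<Sum>\<alpha>\<in>A. J (Deriv (\<alpha> + axis i 1)) * pd (Deriv \<alpha>) F J)"
proof -
  have "{\<alpha>. pd (Deriv \<alpha>) F J \<noteq> 0} \<subseteq> A" using assms(2) by auto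
  then have "(\<Sum>\<alpha> | pd (Deriv \<alpha>) F J \<noteq> 0. J (Deriv (\<alpha> + axis i 1)) * pd (Deriv \<alpha>) F J) =
    (\<Sum>\<alpha>\<in>A. J (Deriv (\<alpha> + axis i 1)) * pd (Deriv \<alpha>) F J)"
    using assms(1) by (intro sum.mono_neutral_left) auto
  then show ?thesis by (simp add: total_deriv_def)
qed

lemma jet_differentiable_const [simp]: "jet_differentiable (\<lambda>J. k)" (is ?th1)
  and pd_const [simp]: "pd c (\<lambda>J. k) = (\<lambda>J. 0)" (is ?th2)
proof -
  have "jet_differentiable (\<lambda>J. k) \<and> (\<forall>c. pd c (\<lambda>J. k) = (\<lambda>J. 0))"
    by (rule jet_differentiableI) auto
  then show ?th1 ?th2 by auto
qed

lemma total_deriv_const [simp]: "total_deriv i (\<lambda>J. k) = (\<lambda>J. 0)"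
  by (simp add: total_deriv_def fun_eq_iff)

context
  fixes F G :: "jet \<Rightarrow> real"
  assumes F: "jet_differentiable F" and G: "jet_differentiable G"
begin

lemma finite_pd_union: "finite {\<alpha>. pd (Deriv \<alpha>) F J \<noteq> 0 \<or> pd (Deriv \<alpha>) G J \<noteq> 0}"
  unfolding Collect_disj_eq by (intro finite_UnI jet_differentiableD(2) F G)

lemma jet_differentiable_add [simp]: "jet_differentiable (\<lambda>J. F J + G J)" (is ?th1)
  and pd_add [simp]: "pd c (\<lambda>J. F J + G J) = (\<lambda>J. pd c F J + pd c G J)" (is ?th2)
proof -
  have "jet_differentiable (\<lambda>J. F J + G J) \<and> (\<forall>c. pd c (\<lambda>J. F J + G J) = (\<lambda>J. pd c F J + pd c G J))"
  proof (rule jet_differentiableI)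
    show "finite {\<alpha>. pd (Deriv \<alpha>) F J + pd (Deriv \<alpha>) G J \<noteq> 0}" for J
      by (rule finite_subset[OF _ finite_pd_union[of J]]) auto
  qed (intro DERIV_add jet_differentiableD F G)
  then show ?th1 ?th2 by auto
qed

lemma jet_differentiable_diff [simp]: "jet_differentiable (\<lambda>J. F J - G J)" (is ?th1)
  and pd_diff [simp]: "pd c (\<lambda>J. F J - G J) = (\<lambda>J. pd c F J - pd c G J)" (is ?th2)
proof -
  have "jet_differentiable (\<lambda>J. F J - G J) \<and> (\<forall>c. pd c (\<lambda>J. F J - G J) = (\<lambda>J. pd c F J - pd c G J))"
  proof (rule jet_differentiableI)
    show "finite {\<alpha>. pd (Deriv \<alpha>) F J - pd (Deriv \<alpha>) G J \<noteq> 0}" for J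
      by (rule finite_subset[OF _ finite_pd_union[of J]]) auto
  qed (intro DERIV_diff jet_differentiableD F G)
  then show ?th1 ?th2 by auto
qed

lemma pd_mult_deriv:
  "((\<lambda>s. F (J(c := s)) * G (J(c := s))) has_real_derivative pd c F J * G J + F J * pd c G J) (at (J c))"
  using DERIV_mult[OF jet_differentiableD(1)[OF F, of J c] jet_differentiableD(1)[OF G, of J c]]
  by (simp add: algebra_simps)

lemma jet_differentiable_mult [simp]: "jet_differentiable (\<lambda>J. F J * G J)" (is ?th1)
  and pd_mult [simp]: "pd c (\<lambda>J. F J * G J) = (\<lambda>J. pd c F J * G J + F J * pd c G J)" (is ?th2)
proof -
  have "jet_differentiable (\<lambda>J. F J * G J) \<and> (\<forall>c. pd c (\<lambda>J. F J * G J) = (\<lambda>J. pd c F J * G J + F J * pd c G J))"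
  proof (rule jet_differentiableI)
    show "finite {\<alpha>. pd (Deriv \<alpha>) F J * G J + F J * pd (Deriv \<alpha>) G J \<noteq> 0}" for J
      by (rule finite_subset[OF _ finite_pd_union[of J]]) auto
  qed (rule pd_mult_deriv)
  then show ?th1 ?th2 by auto
qed

lemma total_deriv_union:
  assumes "jet_differentiable H" "\<And>\<alpha>. pd (Deriv \<alpha>) F J = 0 \<Longrightarrow> pd (Deriv \<alpha>) G J = 0 \<Longrightarrow> pd (Deriv \<alpha>) H J = 0"
  shows "total_deriv i H J = pd (Indep i) H J +
    (\<Sum>\<alpha> | pd (Deriv \<alpha>) F J \<noteq> 0 \<or> pd (Deriv \<alpha>) G J \<noteq> 0. J (Deriv (\<alpha> + axis i 1)) * pd (Deriv \<alpha>) H J)"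
  using assms by (intro total_deriv_eq finite_pd_union) auto

lemma total_deriv_add [simp]:
  "total_deriv i (\<lambda>J. F J + G J) = (\<lambda>J. total_deriv i F J + total_deriv i G J)"
  by (rule ext, subst (1 2 3) total_deriv_union)
    (auto simp: F G sum.distrib distrib_left)

lemma total_deriv_diff [simp]:
  "total_deriv i (\<lambda>J. F J - G J) = (\<lambda>J. total_deriv i F J - total_deriv i G J)"
  by (rule ext, subst (1 2 3) total_deriv_union)
    (auto simp: F G sum_subtractf right_diff_distrib)

lemma total_deriv_mult [simp]:
  "total_deriv i (\<lambda>J. F J * G J) = (\<lambda>J. total_deriv i F J * G J + F J * total_deriv i G J)"
  by (rule ext, subst (1 2 3) total_deriv_union)
    (auto simp: F G sum.distrib algebra_simps sum_distrib_left sum_distrib_right)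

end

lemma jet_differentiable_divide [simp]: "jet_differentiable F \<Longrightarrow> jet_differentiable (\<lambda>J. F J / k)"
  and pd_divide [simp]: "jet_differentiable F \<Longrightarrow> pd c (\<lambda>J. F J / k) = (\<lambda>J. pd c F J / k)"
  using jet_differentiable_mult[of F "\<lambda>J. inverse k"] pd_mult[of F "\<lambda>J. inverse k" c]
  by (simp_all add: divide_inverse)

lemma jet_differentiable_power2 [simp]: "jet_differentiable F \<Longrightarrow> jet_differentiable (\<lambda>J. (F J)\<^sup>2)"
  and pd_power2 [simp]: "jet_differentiable F \<Longrightarrow> pd c (\<lambda>J. (F J)\<^sup>2) = (\<lambda>J. 2 * F J * pd c F J)"
  by (simp_all add: power2_eq_square fun_eq_iff)

lemma jet_differentiable_coord: "jet_differentiable (\<lambda>J. J d)"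
  and pd_coord: "pd c (\<lambda>J. J d) = (\<lambda>J. if c = d then 1 else 0)"
proof -
  have *: "((\<lambda>s. (J(c := s)) d) has_real_derivative (if c = d then 1 else 0)) (at (J c))" for J :: jet and c
    by (cases "c = d") auto
  \<comment> \<open>At most one multi-index survives; if \<open>d\<close> is an \<open>Indep\<close>
    coordinate the set is empty.\<close>
  have "finite {\<alpha>. (if Deriv \<alpha> = d then 1 else 0::real) \<noteq> 0}"
    by (rule finite_subset[of _ "{the_inv Deriv d}"]) (auto simp: the_inv_f_f inj_def split: if_splits)
  from jet_differentiableI[OF * this]
  show "jet_differentiable (\<lambda>J. J d)" "pd c (\<lambda>J. J d) = (\<lambda>J. if c = d then 1 else 0)" by auto
qed

lemma jet_differentiable_jet_x [simp]: "jet_differentiable (jet_x i)"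
  and pd_jet_x [simp]: "pd c (jet_x i) = (\<lambda>J. if c = Indep i then 1 else 0)"
  and jet_differentiable_jet_u [simp]: "jet_differentiable jet_u"
  and pd_jet_u [simp]: "pd c jet_u = (\<lambda>J. if c = Deriv 0 then 1 else 0)"
  and jet_differentiable_jet_u1 [simp]: "jet_differentiable (jet_u1 i)"
  and pd_jet_u1 [simp]: "pd c (jet_u1 i) = (\<lambda>J. if c = Deriv (axis i 1) then 1 else 0)"
  and jet_differentiable_jet_u2 [simp]: "jet_differentiable (jet_u2 i j)"
  and pd_jet_u2 [simp]: "pd c (jet_u2 i j) = (\<lambda>J. if c = Deriv (axis i 1 + axis j 1) then 1 else 0)"
  unfolding jet_x_def[abs_def] jet_u_def[abs_def] jet_u1_def[abs_def] jet_u2_def[abs_def]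
  by (rule jet_differentiable_coord pd_coord)+

lemma total_deriv_jet_x [simp]: "total_deriv i (jet_x j) = (\<lambda>J. if i = j then 1 else 0)"
  and total_deriv_jet_u [simp]: "total_deriv i jet_u = jet_u1 i"
  and total_deriv_jet_u1 [simp]: "total_deriv i (jet_u1 j) = jet_u2 j i"
  by (auto simp: total_deriv_def fun_eq_iff jet_u1_def jet_u2_def Collect_conv_if)

section \<open>Functions of (x, u) as functions on jet space\<close>

definition dx :: "3 \<Rightarrow> ((real^3) \<times> real \<Rightarrow> real) \<Rightarrow> (real^3) \<times> real \<Rightarrow> real" where
  "dx i F z = frechet_derivative F (at z) (axis i 1, 0)"

definition du :: "((real^3) \<times> real \<Rightarrow> real) \<Rightarrow> (real^3) \<times> real \<Rightarrow> real" where
  "du F z = frechet_derivative F (at z) (0, 1)"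

lemma smooth_dx [simp, intro]: "smooth F \<Longrightarrow> smooth (dx i F)"
  and smooth_du [simp, intro]: "smooth F \<Longrightarrow> smooth (du F)"
  unfolding dx_def[abs_def] du_def[abs_def]
  by (auto intro!: smooth_frechet simp: Basis_prod_def axis_in_Basis_iff)

text \<open>The new point is written as a step along a straight line, so that a jet partial becomes
  the line derivative of \<open>smooth_line_deriv\<close>.\<close>

lemma jet_point_simps:
  "jet_point (J(Indep i := s)) = jet_point J + (s - J (Indep i)) *\<^sub>R (axis i 1, 0)"
  "jet_point (J(Deriv 0 := s)) = jet_point J + (s - J (Deriv 0)) *\<^sub>R (0, 1)"
  "\<alpha> \<noteq> 0 \<Longrightarrow> jet_point (J(Deriv \<alpha> := s)) = jet_point J"
  by (auto simp: jet_point_def vec_eq_iff axis_def jet_x_def jet_u_def)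

lemma
  assumes F: "smooth F"
  shows jet_differentiable_base [simp]: "jet_differentiable (\<lambda>J. F (jet_point J))"
    and pd_base: "pd (Indep i) (\<lambda>J. F (jet_point J)) = (\<lambda>J. dx i F (jet_point J))"
      "pd (Deriv \<alpha>) (\<lambda>J. F (jet_point J)) = (\<lambda>J. if \<alpha> = 0 then du F (jet_point J) else 0)"
    and total_deriv_base [simp]: "total_deriv i (\<lambda>J. F (jet_point J)) =
      (\<lambda>J. dx i F (jet_point J) + jet_u1 i J * du F (jet_point J))"
proof -
  define g where "g c J = (case c of Indep i \<Rightarrow> dx i F (jet_point J)
      | Deriv \<alpha> \<Rightarrow> if \<alpha> = 0 then du F (jet_point J) else 0)" for c J
  have line: "((\<lambda>s. F (q + (s - r) *\<^sub>R a)) has_real_derivative frechet_derivative F (at q) a) (at r)"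
    for q r a
  proof -
    have "((\<lambda>s. F (q + s *\<^sub>R a)) has_real_derivative frechet_derivative F (at q) a) (at (r - r))"
      using smooth_line_deriv[OF F, of q a "r - r"] by (simp add: has_real_derivative_iff_has_vector_derivative)
    from DERIV_chain2[OF this DERIV_diff[OF DERIV_ident DERIV_const]] show ?thesis by simp
  qed
  have *: "((\<lambda>s. F (jet_point (J(c := s)))) has_real_derivative g c J) (at (J c))" for c J
  proof (cases c)
    case (Indep i)
    then show ?thesis using line[of "jet_point J" "J (Indep i)" "(axis i 1, 0)" for i]
      by (simp only: g_def coord.case jet_point_simps dx_def)
  next
    case (Deriv \<alpha>)
    show ?thesis
    proof (cases "\<alpha> = 0")
      case True
      then show ?thesis using line[of "jet_point J" "J (Deriv 0)" "(0, 1)"]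
        by (simp add: Deriv g_def jet_point_simps du_def del: scaleR_Pair)
    next
      case False
      then show ?thesis by (simp add: Deriv g_def jet_point_simps)
    qed
  qed
  have fin: "finite {\<alpha>. g (Deriv \<alpha>) J \<noteq> 0}" for J
    by (rule finite_subset[of _ "{0}"]) (auto simp: g_def)
  show "jet_differentiable (\<lambda>J. F (jet_point J))"
    using jet_differentiableI[OF * fin] by blast
  have pd: "pd c (\<lambda>J. F (jet_point J)) J = g c J" for c J
    using jet_differentiableI[OF * fin] by simp
  then show "pd (Indep i) (\<lambda>J. F (jet_point J)) = (\<lambda>J. dx i F (jet_point J))"
      "pd (Deriv \<alpha>) (\<lambda>J. F (jet_point J)) = (\<lambda>J. if \<alpha> = 0 then du F (jet_point J) else 0)"
    by (simp_all add: fun_eq_iff g_def)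
  show "total_deriv i (\<lambda>J. F (jet_point J)) =
      (\<lambda>J. dx i F (jet_point J) + jet_u1 i J * du F (jet_point J))"
    by (rule ext, subst total_deriv_eq[of "{0}"]) (auto simp: pd g_def jet_u1_def)
qed

lemma dx_du_simps [simp]:
  "smooth F \<Longrightarrow> smooth G \<Longrightarrow> dx i (\<lambda>z. F z + G z) = (\<lambda>z. dx i F z + dx i G z)"
  "smooth F \<Longrightarrow> smooth G \<Longrightarrow> du (\<lambda>z. F z + G z) = (\<lambda>z. du F z + du G z)"
  "smooth F \<Longrightarrow> smooth G \<Longrightarrow> dx i (\<lambda>z. F z * G z) = (\<lambda>z. dx i F z * G z + F z * dx i G z)"
  "smooth F \<Longrightarrow> smooth G \<Longrightarrow> du (\<lambda>z. F z * G z) = (\<lambda>z. du F z * G z + F z * du G z)"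
  "dx i (\<lambda>z. k) = (\<lambda>z. 0)" "du (\<lambda>z. k) = (\<lambda>z. 0)" "dx i snd = (\<lambda>z. 0)" "du snd = (\<lambda>z. 1)"
  unfolding dx_def[abs_def] du_def[abs_def]
  by (auto simp: fun_eq_iff
      frechet_derivative_at[OF has_derivative_add[OF smooth_has_derivative smooth_has_derivative], symmetric]
      frechet_derivative_at[OF has_derivative_mult[OF smooth_has_derivative smooth_has_derivative], symmetric]
      frechet_derivative_at[OF has_derivative_snd[OF has_derivative_ident], symmetric])

lemma frechet_fst:
  assumes "smooth f"
  shows "frechet_derivative (\<lambda>z. f (fst z)) (at z) v = frechet_derivative f (at (fst z)) (fst v)"
proof -
  have "((\<lambda>z. f (fst z)) has_derivative (\<lambda>v. frechet_derivative f (at (fst z)) (fst v))) (at z)"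
    using diff_chain_at[OF has_derivative_fst[OF has_derivative_ident] smooth_has_derivative[OF assms]]
    by (simp add: o_def)
  from frechet_derivative_at[OF this, THEN fun_cong] show ?thesis by (rule sym)
qed

lemma dx_du_fst [simp]:
  "smooth f \<Longrightarrow> dx i (\<lambda>z. f (fst z)) = (\<lambda>z. partial i f (fst z))"
  "smooth f \<Longrightarrow> du (\<lambda>z. f (fst z)) = (\<lambda>z. 0)"
  by (auto simp: dx_def du_def fun_eq_iff frechet_fst partial_def
      linear_0[OF has_derivative_linear[OF smooth_has_derivative]])

lemma fst_nth_simps [simp]:
  "smooth (\<lambda>z. fst z $ j :: real)"
  "dx i (\<lambda>z. fst z $ j) = (\<lambda>z. if i = j then 1 else 0)"
  "du (\<lambda>z. fst z $ j) = (\<lambda>z. 0)"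
  using smooth_fst[of "\<lambda>p. p $ j"] dx_du_fst[of "\<lambda>p. p $ j"] by auto

lemma dx_du_divide [simp]:
  "smooth F \<Longrightarrow> dx i (\<lambda>z. F z / r) = (\<lambda>z. dx i F z / r)"
  "smooth F \<Longrightarrow> du (\<lambda>z. F z / r) = (\<lambda>z. du F z / r)"
  using dx_du_simps(3)[of F "\<lambda>_. inverse r" i] dx_du_simps(4)[of F "\<lambda>_. inverse r"]
  by (simp_all add: divide_inverse)

lemma dx_du_diff [simp]:
  "smooth F \<Longrightarrow> smooth G \<Longrightarrow> dx i (\<lambda>z. F z - G z) = (\<lambda>z. dx i F z - dx i G z)"
  "smooth F \<Longrightarrow> smooth G \<Longrightarrow> du (\<lambda>z. F z - G z) = (\<lambda>z. du F z - du G z)"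
  using dx_du_simps(1)[of F "\<lambda>z. (- 1) * G z" i] dx_du_simps(2)[of F "\<lambda>z. (- 1) * G z"]
    dx_du_simps(3)[of "\<lambda>z. - 1" G i] dx_du_simps(4)[of "\<lambda>z. - 1" G]
  by simp_all

section \<open>Prolongations\<close>

text \<open>These identities decide which jet coordinates coincide, hence which partials vanish.
  Orders one and two are told apart by the sum of the entries; for two pairs, evaluating at
  \<open>i\<close> shows that \<open>i\<close> occurs on the other side, and cancellation gives the
  rest.\<close>

lemma axis_nat_eq_iff:
  fixes i j k l :: 3
  shows "axis i (1::nat) \<noteq> 0" "0 \<noteq> axis i (1::nat)" "axis i (1::nat) = axis k 1 \<longleftrightarrow> i = k"
    "axis i (1::nat) + axis j 1 \<noteq> 0" "0 \<noteq> axis i (1::nat) + axis j 1"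
    "axis i (1::nat) \<noteq> axis j 1 + axis k 1" "axis j (1::nat) + axis k 1 \<noteq> axis i 1"
    "axis i (1::nat) + axis j 1 = axis k 1 + axis l 1 \<longleftrightarrow> i = k \<and> j = l \<or> i = l \<and> j = k"
proof -
  have ax: "axis i (1::nat) $ j = of_bool (j = i)" "axis i (Suc 0) $ j = of_bool (j = i)" for i j :: 3
    by (simp_all add: axis_def)
  note eq = vec_eq_iff forall_3 ax vector_add_component zero_index
  show "axis i (1::nat) \<noteq> 0" "0 \<noteq> axis i (1::nat)" "axis i (1::nat) = axis k 1 \<longleftrightarrow> i = k"
    by (simp_all add: axis_eq_axis)
  show "axis i (1::nat) + axis j 1 \<noteq> 0" "0 \<noteq> axis i (1::nat) + axis j 1"
    using exhaust_3[of i] by (auto simp: eq)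
  have "(\<Sum>l\<in>UNIV. axis i (1::nat) $ l) \<noteq> (\<Sum>l\<in>UNIV. (axis j 1 + axis k 1) $ l)" for i j k :: 3
    by (simp add: sum.distrib axis_def)
  then show "axis i (1::nat) \<noteq> axis j 1 + axis k 1" "axis j (1::nat) + axis k 1 \<noteq> axis i 1"
    by metis+
  show "axis i (1::nat) + axis j 1 = axis k 1 + axis l 1 \<longleftrightarrow> i = k \<and> j = l \<or> i = l \<and> j = k"
  proof
    assume *: "axis i (1::nat) + axis j 1 = axis k 1 + axis l 1"
    have "of_bool (i = i) + of_bool (i = j) = of_bool (i = k) + (of_bool (i = l) :: nat)"
      using arg_cong[OF *, of "\<lambda>v. v $ i"] by (simp only: ax vector_add_component)
    then have "i = k \<or> i = l" by (cases "i = k"; cases "i = l"; simp)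
    moreover have "axis i (1::nat) + axis j 1 = axis l 1 + axis k 1"
      using * by (simp only: add.commute)
    ultimately show "i = k \<and> j = l \<or> i = l \<and> j = k"
      using * by (metis add_left_cancel axis_eq_axis one_neq_zero)
  qed (auto simp: add.commute)
qed

text \<open>The simplifier rewrites \<open>1::nat\<close> to \<open>Suc 0\<close>, so only the
  unfolded forms can match.\<close>

lemmas axis_nat_eq_iff_Suc [simp] = axis_nat_eq_iff[unfolded One_nat_def]

lemma distinct_3 [simp]:
  "(1::3) \<noteq> 2" "(1::3) \<noteq> 3" "(2::3) \<noteq> 1" "(2::3) \<noteq> 3" "(3::3) \<noteq> 1" "(3::3) \<noteq> 2"
  by simp_all

lemma pairs_3: "{(i, j). i \<le> (j::3)} = {(3, 3), (3, 1), (3, 2), (1, 1), (1, 2), (2, 2)}"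
proof -
  have less: "(3::3) < 1" "(1::3) < 2"
    by (simp_all add: less_bit1_def bit1.Rep_numeral bit1.Rep_1)
  then have "(3::3) < 2" by (rule less_trans)
  note le = less[THEN less_imp_le] this[THEN less_imp_le] less[folded not_le] this[folded not_le]
  have "(i \<le> j) = ((i, j) \<in> {(3, 3), (3, 1), (3, 2), (1, 1), (1, 2), (2, 2)})" for i j :: 3
    using exhaust_3[of i] exhaust_3[of j]
    by (elim disjE; hypsubst; simp only: le order.refl distinct_3 insert_iff prod.inject simp_thms empty_iff)
  then show ?thesis by auto
qed

lemma jet_u2_sym: "jet_u2 i j = jet_u2 j i"
  by (simp add: jet_u2_def[abs_def] add.commute)

lemma smooth_vfield_component:
  assumes "smooth S"
  shows "smooth (\<lambda>z. fst (S z) $ i)" "smooth (\<lambda>z. snd (S z))"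
  using smooth_bounded_linear[OF bounded_linear_compose[OF bounded_linear_vec_nth bounded_linear_fst] assms]
    smooth_bounded_linear[OF bounded_linear_snd assms] by auto

lemma prolong2_kohn_laplace:
  "prolong2 S kohn_laplace_jet J =
     xi S 1 J * (8 * jet_x 1 J * jet_u2 3 3 J - 4 * jet_u2 2 3 J)
     + xi S 2 J * (8 * jet_x 2 J * jet_u2 3 3 J + 4 * jet_u2 1 3 J)
     + eta2 S 1 1 J + eta2 S 2 2 J + 4 * ((jet_x 1 J)\<^sup>2 + (jet_x 2 J)\<^sup>2) * eta2 S 3 3 J
     + 4 * jet_x 2 J * eta2 S 3 1 J - 4 * jet_x 1 J * eta2 S 3 2 J"
  unfolding prolong2_def prolong1_def kohn_laplace_jet_def[abs_def] pairs_3
  by (simp add: sum_3) (simp add: algebra_simps)?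

lemma prolong1_lagrangian:
  "prolong1 S lagrangian J =
     xi S 1 J * (4 * jet_x 1 J * (jet_u1 3 J)\<^sup>2 - 2 * jet_u1 2 J * jet_u1 3 J)
     + xi S 2 J * (4 * jet_x 2 J * (jet_u1 3 J)\<^sup>2 + 2 * jet_u1 1 J * jet_u1 3 J)
     + eta1 S 1 J * (jet_u1 1 J + 2 * jet_x 2 J * jet_u1 3 J)
     + eta1 S 2 J * (jet_u1 2 J - 2 * jet_x 1 J * jet_u1 3 J)
     + eta1 S 3 J * (4 * ((jet_x 1 J)\<^sup>2 + (jet_x 2 J)\<^sup>2) * jet_u1 3 J
         + 2 * jet_x 2 J * jet_u1 1 J - 2 * jet_x 1 J * jet_u1 2 J)"
  unfolding prolong1_def lagrangian_def[abs_def]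
  by (simp add: sum_3) (simp add: algebra_simps)?

context
  fixes X :: "3 \<Rightarrow> (real^3) \<times> real \<Rightarrow> real" and E and S :: vfield
  assumes X: "\<And>i. smooth (X i)" and E: "smooth E"
    and S: "S = (\<lambda>z. (\<chi> i. X i z, E z))"
begin

lemma xi_eq: "xi S i = (\<lambda>J. X i (jet_point J))"
  by (simp add: xi_def fun_eq_iff S)

lemma eta_eq: "eta S = (\<lambda>J. E (jet_point J))"
  by (simp add: eta_def fun_eq_iff S)

lemma eta1_eq:
  "eta1 S i = (\<lambda>J. dx i E (jet_point J) + jet_u1 i J * du E (jet_point J)
    - ((dx i (X 1) (jet_point J) + jet_u1 i J * du (X 1) (jet_point J)) * jet_u1 1 J
     + (dx i (X 2) (jet_point J) + jet_u1 i J * du (X 2) (jet_point J)) * jet_u1 2 J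
     + (dx i (X 3) (jet_point J) + jet_u1 i J * du (X 3) (jet_point J)) * jet_u1 3 J))"
  by (simp add: eta1_def[abs_def] xi_eq eta_eq sum_3 X E)

lemma eta2_eq:
  "eta2 S i j J = (let z = jet_point J in
    dx j (dx i E) z + jet_u1 j J * du (dx i E) z + jet_u2 i j J * du E z
    + jet_u1 i J * (dx j (du E) z + jet_u1 j J * du (du E) z)
    - (\<Sum>k\<in>UNIV. (dx j (dx i (X k)) z + jet_u1 j J * du (dx i (X k)) z + jet_u2 i j J * du (X k) z
        + jet_u1 i J * (dx j (du (X k)) z + jet_u1 j J * du (du (X k)) z)) * jet_u1 k J
      + (dx i (X k) z + jet_u1 i J * du (X k) z) * jet_u2 k j J
      + (dx j (X k) z + jet_u1 j J * du (X k) z) * jet_u2 i k J))"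
  unfolding eta2_def eta1_eq xi_eq
  by (simp add: X E sum_3 Let_def) (simp add: algebra_simps)

end

section \<open>Point symmetries\<close>

definition affine_field :: "(3 \<Rightarrow> real^3 \<Rightarrow> real) \<Rightarrow> (real^3 \<Rightarrow> real) \<Rightarrow> (real^3 \<Rightarrow> real) \<Rightarrow> vfield" where
  "affine_field \<xi> c b = (\<lambda>z. (\<chi> i. \<xi> i (fst z), c (fst z) * snd z + b (fst z)))"

lemma smooth_affine_field:
  assumes "\<And>i. smooth (\<xi> i)" "smooth c" "smooth b"
  shows "smooth (affine_field \<xi> c b)"
proof -
  have L: "bounded_linear (\<lambda>r. (r *\<^sub>R axis i 1, 0) :: (real^3) \<times> real)" for i
    by (intro bounded_linear_Pair bounded_linear_scaleR_left bounded_linear_zero)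
  have M: "bounded_linear (\<lambda>r. (0, r) :: (real^3) \<times> real)"
    by (intro bounded_linear_Pair bounded_linear_ident bounded_linear_zero)
  have "affine_field \<xi> c b = (\<lambda>z. (\<xi> 1 (fst z) *\<^sub>R axis 1 1, 0) + (\<xi> 2 (fst z) *\<^sub>R axis 2 1, 0)
      + (\<xi> 3 (fst z) *\<^sub>R axis 3 1, 0) + (0, c (fst z) * snd z + b (fst z)))"
    by (auto simp: affine_field_def fun_eq_iff vec_eq_iff forall_3 axis_def)
  moreover have "smooth \<dots>"
    using assms by (intro smooth_add smooth_bounded_linear[OF L] smooth_bounded_linear[OF M]) auto
  ultimately show ?thesis by simp
qed

lemma fst_jet_point: "fst (jet_point J) $ i = jet_x i J" "snd (jet_point J) = jet_u J"
  by (simp_all add: jet_point_def)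

lemma jet_u2_swap: "jet_u2 2 1 = jet_u2 1 2" "jet_u2 3 1 = jet_u2 1 3" "jet_u2 3 2 = jet_u2 2 3"
  by (rule jet_u2_sym)+

lemma partial_swap:
  assumes "smooth f"
  shows "partial 1 (partial 2 f) = partial 2 (partial 1 f)"
    "partial 1 (partial 3 f) = partial 3 (partial 1 f)"
    "partial 2 (partial 3 f) = partial 3 (partial 2 f)"
  by (intro partial_commute assms)+

text \<open>The terms are sorted by jet coordinate, with the multiple of the equation split off. On
  the equation the first summand vanishes, and the remaining coefficients yield the determining
  equations, up to the one linear relation among the second derivatives.\<close>

lemma prolong2_affine_field:
  fixes \<xi> c b J
  assumes \<xi>: "\<And>i. smooth (\<xi> i)" and c: "smooth c" and b: "smooth b"
  defines "p \<equiv> fst (jet_point J)"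
  defines "x \<equiv> p $ 1" and "y \<equiv> p $ 2"
  shows "prolong2 (affine_field \<xi> c b) kohn_laplace_jet J =
    c p * kohn_laplace_jet J + jet_u J * kohn_laplace c p + kohn_laplace b p
    + jet_u1 1 J * (2 * (partial 1 c p + 2 * y * partial 3 c p) - kohn_laplace (\<xi> 1) p)
    + jet_u1 2 J * (2 * (partial 2 c p - 2 * x * partial 3 c p) - kohn_laplace (\<xi> 2) p)
    + jet_u1 3 J * (2 * (2 * y * partial 1 c p - 2 * x * partial 2 c p + 4 * (x^2 + y^2) * partial 3 c p)
        - kohn_laplace (\<xi> 3) p)
    - jet_u2 1 1 J * (2 * (partial 1 (\<xi> 1) p + 2 * y * partial 3 (\<xi> 1) p))
    - jet_u2 2 2 J * (2 * (partial 2 (\<xi> 2) p - 2 * x * partial 3 (\<xi> 2) p))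
    - jet_u2 1 2 J * (2 * (partial 1 (\<xi> 2) p + 2 * y * partial 3 (\<xi> 2) p
        + partial 2 (\<xi> 1) p - 2 * x * partial 3 (\<xi> 1) p))
    + jet_u2 1 3 J * (4 * \<xi> 2 p - 2 * (partial 1 (\<xi> 3) p + 2 * y * partial 3 (\<xi> 3) p
        + 2 * y * partial 1 (\<xi> 1) p - 2 * x * partial 2 (\<xi> 1) p + 4 * (x^2 + y^2) * partial 3 (\<xi> 1) p))
    + jet_u2 2 3 J * (- 4 * \<xi> 1 p - 2 * (partial 2 (\<xi> 3) p - 2 * x * partial 3 (\<xi> 3) p
        + 2 * y * partial 1 (\<xi> 2) p - 2 * x * partial 2 (\<xi> 2) p + 4 * (x^2 + y^2) * partial 3 (\<xi> 2) p))
    + jet_u2 3 3 J * (8 * x * \<xi> 1 p + 8 * y * \<xi> 2 p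
        - 2 * (2 * y * partial 1 (\<xi> 3) p - 2 * x * partial 2 (\<xi> 3) p + 4 * (x^2 + y^2) * partial 3 (\<xi> 3) p))"
proof -
  let ?X = "\<lambda>i z. \<xi> i (fst z)" and ?E = "\<lambda>z. c (fst z) * snd z + b (fst z)"
  have X: "smooth (?X i)" and E: "smooth ?E" for i
    using assms by auto
  note eqs = xi_eq[OF X E affine_field_def] eta2_eq[OF X E affine_field_def]
  have xy: "jet_x 1 J = x" "jet_x 2 J = y" "snd (jet_point J) = jet_u J"
    by (simp_all add: x_def y_def p_def fst_jet_point)
  show ?thesis
    unfolding prolong2_kohn_laplace eqs
    by (simp add: \<xi> c b sum_3 Let_def xy p_def[symmetric] jet_u2_swap partial_swap
        kohn_laplace_def kohn_laplace_jet_def x_def[symmetric] y_def[symmetric])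
      (simp add: algebra_simps)
qed

text \<open>Values up to second order can be prescribed freely because the multi-indices involved
  are distinct; this is what permits comparing coefficients.\<close>

lemma jet_exists:
  obtains J where "jet_point J = z" "jet_u1 1 J = p1" "jet_u1 2 J = p2" "jet_u1 3 J = p3"
    "jet_u2 1 1 J = r11" "jet_u2 2 2 J = r22" "jet_u2 3 3 J = r33"
    "jet_u2 1 2 J = r12" "jet_u2 1 3 J = r13" "jet_u2 2 3 J = r23"
proof -
  define J :: jet where "J = (\<lambda>c. case c of Indep i \<Rightarrow> fst z $ i | Deriv \<alpha> \<Rightarrow> if \<alpha> = 0 then snd z else 0)"
  define J' where "J' = J(Deriv (axis 1 1) := p1, Deriv (axis 2 1) := p2, Deriv (axis 3 1) := p3,
    Deriv (axis 1 1 + axis 1 1) := r11, Deriv (axis 2 1 + axis 2 1) := r22,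
    Deriv (axis 3 1 + axis 3 1) := r33, Deriv (axis 1 1 + axis 2 1) := r12,
    Deriv (axis 1 1 + axis 3 1) := r13, Deriv (axis 2 1 + axis 3 1) := r23)"
  show thesis
    by (rule that[of J'])
      (simp_all add: jet_point_def jet_x_def jet_u_def jet_u1_def jet_u2_def J'_def J_def prod_eq_iff)
qed

section \<open>Reduction to fields that are affine in u\<close>

lemma dx_du_commute: "smooth F \<Longrightarrow> dx i (du F) = du (dx i F)"
  unfolding dx_def[abs_def] du_def[abs_def]
  by (intro ext smooth_frechet_commute) (auto simp: Basis_prod_def axis_in_Basis_iff)

lemma has_derivative_vertical:
  "smooth F \<Longrightarrow> ((\<lambda>s. F (p, s)) has_real_derivative du F (p, s)) (at s)"
  using smooth_line_deriv[of F "(p, 0)" "(0, 1)" s]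
  by (simp add: has_real_derivative_iff_has_vector_derivative du_def)

lemma point_symmetry_affine:
  assumes "lie_point_symmetry S"
  obtains \<xi> c b where "S = affine_field \<xi> c b" "\<And>i. smooth (\<xi> i)" "smooth c" "smooth b"
proof -
  have S: "smooth S" and sym: "\<And>J. kohn_laplace_jet J = 0 \<Longrightarrow> prolong2 S kohn_laplace_jet J = 0"
    using assms by (auto simp: lie_point_symmetry_def)
  define X E where "X = (\<lambda>i z. fst (S z) $ i)" and "E = (\<lambda>z. snd (S z))"
  have X: "smooth (X i)" and E: "smooth E" for i
    using smooth_vfield_component[OF S] by (auto simp: X_def E_def)
  have S_eq: "S = (\<lambda>z. (\<chi> i. X i z, E z))"
    by (simp add: X_def E_def)
  note eqs = prolong2_kohn_laplace xi_eq[OF X E S_eq] eta2_eq[OF X E S_eq]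
  have duX: "du (X 1) z = 0 \<and> du (X 2) z = 0 \<and> du (X 3) z = 0" for z
  proof -
    define x y where "x = fst z $ 1" and "y = fst z $ 2"
    \<comment> \<open>The jets \<open>J1\<close> to \<open>J4\<close> combine first derivatives p or
      0 with second derivatives r or 0. The difference P(J1) - P(J2) - P(J3) + P(J4) of the
      prolonged equation keeps only products of one first and one second derivative, and these carry
      the factors \<open>du (X k) z\<close>. The part proportional to the equation itself drops
      out.\<close>
    have mixed: "2 * (p1 * (r11 * du (X 1) z + r12 * du (X 2) z + r13 * du (X 3) z)
        + p2 * (r12 * du (X 1) z + r22 * du (X 2) z + r23 * du (X 3) z)
        + 2 * (y * p1 - x * p2) * (r13 * du (X 1) z + r23 * du (X 2) z)) = 0"
      if r: "r11 + r22 + 4 * y * r13 - 4 * x * r23 = 0" for p1 p2 r11 r22 r12 r13 r23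
    proof -
      obtain J1 where J1: "jet_point J1 = z" "jet_u1 1 J1 = p1" "jet_u1 2 J1 = p2" "jet_u1 3 J1 = 0"
        "jet_u2 1 1 J1 = r11" "jet_u2 2 2 J1 = r22" "jet_u2 3 3 J1 = 0"
        "jet_u2 1 2 J1 = r12" "jet_u2 1 3 J1 = r13" "jet_u2 2 3 J1 = r23" by (rule jet_exists)
      obtain J2 where J2: "jet_point J2 = z" "jet_u1 1 J2 = p1" "jet_u1 2 J2 = p2" "jet_u1 3 J2 = 0"
        "jet_u2 1 1 J2 = 0" "jet_u2 2 2 J2 = 0" "jet_u2 3 3 J2 = 0"
        "jet_u2 1 2 J2 = 0" "jet_u2 1 3 J2 = 0" "jet_u2 2 3 J2 = 0" by (rule jet_exists)
      obtain J3 where J3: "jet_point J3 = z" "jet_u1 1 J3 = 0" "jet_u1 2 J3 = 0" "jet_u1 3 J3 = 0"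
        "jet_u2 1 1 J3 = r11" "jet_u2 2 2 J3 = r22" "jet_u2 3 3 J3 = 0"
        "jet_u2 1 2 J3 = r12" "jet_u2 1 3 J3 = r13" "jet_u2 2 3 J3 = r23" by (rule jet_exists)
      obtain J4 where J4: "jet_point J4 = z" "jet_u1 1 J4 = 0" "jet_u1 2 J4 = 0" "jet_u1 3 J4 = 0"
        "jet_u2 1 1 J4 = 0" "jet_u2 2 2 J4 = 0" "jet_u2 3 3 J4 = 0"
        "jet_u2 1 2 J4 = 0" "jet_u2 1 3 J4 = 0" "jet_u2 2 3 J4 = 0" by (rule jet_exists)
      have xy: "jet_point J = z \<Longrightarrow> jet_x 1 J = x" "jet_point J = z \<Longrightarrow> jet_x 2 J = y" for J
        by (auto simp: x_def y_def fst_jet_point)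
      have r11: "r11 = - r22 - 4 * y * r13 + 4 * x * r23" using r by simp
      have "kohn_laplace_jet J1 = 0" "kohn_laplace_jet J2 = 0" "kohn_laplace_jet J3 = 0" "kohn_laplace_jet J4 = 0"
        by (simp_all add: kohn_laplace_jet_def J1 J2 J3 J4 xy r11)
      \<comment> \<open>Here \<open>sym\<close> is the local symmetry condition, not symmetry of
        equality.\<close>
      from this[THEN sym]
      show ?thesis
        by (simp add: eqs J1 J2 J3 J4 xy jet_u2_swap Let_def sum_3 r11) algebra
    qed
    \<comment> \<open>The arguments are r11, r22, r13, r23, p1, r12, p2. The first two choices
      isolate \<open>du (X 2) z\<close> and \<open>du (X 1) z\<close>. In the third, u_13 = 1 brings
      in \<open>du (X 3) z\<close>, and u_11 = - 4 y keeps the jet on the equation.\<close>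
    from mixed[of 0 0 0 0 1 1 0] mixed[of 0 0 0 0 0 1 1] mixed[of "- 4 * y" 0 1 0 1 "2 * x" 0]
    show ?thesis by simp
  qed
  then have duX: "du (X i) = (\<lambda>z. 0)" for i
    using exhaust_3[of i] by auto
  \<comment> \<open>The second difference in u_1 over 1, 0, -1, with all other derivatives 0,
    isolates the coefficient of u_1^2. The contribution of \<open>X 1\<close> to it is a
    u-derivative and already vanishes.\<close>
  have duE: "du (du E) z = 0" for z
  proof -
    obtain J1 where J1: "jet_point J1 = z" "jet_u1 1 J1 = 1" "jet_u1 2 J1 = 0" "jet_u1 3 J1 = 0"
      "jet_u2 1 1 J1 = 0" "jet_u2 2 2 J1 = 0" "jet_u2 3 3 J1 = 0"
      "jet_u2 1 2 J1 = 0" "jet_u2 1 3 J1 = 0" "jet_u2 2 3 J1 = 0" by (rule jet_exists)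
    obtain J2 where J2: "jet_point J2 = z" "jet_u1 1 J2 = -1" "jet_u1 2 J2 = 0" "jet_u1 3 J2 = 0"
      "jet_u2 1 1 J2 = 0" "jet_u2 2 2 J2 = 0" "jet_u2 3 3 J2 = 0"
      "jet_u2 1 2 J2 = 0" "jet_u2 1 3 J2 = 0" "jet_u2 2 3 J2 = 0" by (rule jet_exists)
    obtain J3 where J3: "jet_point J3 = z" "jet_u1 1 J3 = 0" "jet_u1 2 J3 = 0" "jet_u1 3 J3 = 0"
      "jet_u2 1 1 J3 = 0" "jet_u2 2 2 J3 = 0" "jet_u2 3 3 J3 = 0"
      "jet_u2 1 2 J3 = 0" "jet_u2 1 3 J3 = 0" "jet_u2 2 3 J3 = 0" by (rule jet_exists)
    have xy: "jet_point J = z \<Longrightarrow> jet_x i J = fst z $ i" for i J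
      by (auto simp: fst_jet_point)
    have du_dx: "du (dx j (X i)) = (\<lambda>z. 0)" for i j
      by (simp add: dx_du_commute[OF X, symmetric] duX)
    have "kohn_laplace_jet J1 = 0" "kohn_laplace_jet J2 = 0" "kohn_laplace_jet J3 = 0"
      by (simp_all add: kohn_laplace_jet_def J1 J2 J3)
    from this[THEN sym]
    show ?thesis
      by (simp add: eqs J1 J2 J3 xy jet_u2_swap Let_def sum_3 duX du_dx) algebra
  qed
  have const: "F (p, s) = F (p, 0)" if "smooth F" "\<And>z. du F z = 0" for F p s
    using DERIV_isconst_all[of "\<lambda>s. F (p, s)" s 0] has_derivative_vertical[OF that(1), of p] that(2) by auto
  define c where "c = (\<lambda>p. du E (p, 0))"
  have "E (p, s) = c p * s + E (p, 0)" for p s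
  proof -
    have *: "du E (p, s) = c p" for s
      using const[OF smooth_du[OF E] duE] by (simp add: c_def)
    have "((\<lambda>s. E (p, s) - c p * s) has_real_derivative du E (p, s) - c p * 1) (at s)" for s
      by (intro DERIV_diff has_derivative_vertical E DERIV_cmult DERIV_ident)
    then have "((\<lambda>s. E (p, s) - c p * s) has_real_derivative 0) (at s)" for s
      using * by simp
    from DERIV_isconst_all[OF allI[OF this], of s 0] show ?thesis by simp
  qed
  then have E': "E z = c (fst z) * snd z + E (fst z, 0)" for z by (metis prod.collapse)
  have X': "X i z = X i (fst z, 0)" for i z
    using const[OF X, of i "fst z" "snd z"] duX by simp
  have "S = affine_field (\<lambda>i p. X i (p, 0)) c (\<lambda>p. E (p, 0))"
    unfolding S_eq affine_field_def E'[symmetric] X'[symmetric] ..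
  then show thesis
    using that smooth_slice[OF X] smooth_slice[OF smooth_du[OF E]] smooth_slice[OF E]
    unfolding c_def by blast
qed

text \<open>At u = 0 the prolonged equation is affine in the remaining jet coordinates, so each
  equation comes from one direction tangent to the linear relation between the second derivatives.
  The last two express that the flow preserves the horizontal planes.\<close>

lemma determining_equations:
  assumes "lie_point_symmetry (affine_field \<xi> c b)"
    and s: "\<And>i. smooth (\<xi> i)" "smooth c" "smooth b"
  shows "kohn_laplace b p = 0"
    "kohn_laplace (\<xi> 1) p = 2 * (partial 1 c p + 2 * p $ 2 * partial 3 c p)"
    "kohn_laplace (\<xi> 2) p = 2 * (partial 2 c p - 2 * p $ 1 * partial 3 c p)"
    "partial 1 (\<xi> 1) p + 2 * p $ 2 * partial 3 (\<xi> 1) p = partial 2 (\<xi> 2) p - 2 * p $ 1 * partial 3 (\<xi> 2) p"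
    "partial 1 (\<xi> 2) p + 2 * p $ 2 * partial 3 (\<xi> 2) p = - (partial 2 (\<xi> 1) p - 2 * p $ 1 * partial 3 (\<xi> 1) p)"
    "partial 1 (\<xi> 3) p + 2 * p $ 2 * partial 3 (\<xi> 3) p =
       2 * \<xi> 2 p + 2 * p $ 2 * (partial 1 (\<xi> 1) p + 2 * p $ 2 * partial 3 (\<xi> 1) p)
       - 2 * p $ 1 * (partial 1 (\<xi> 2) p + 2 * p $ 2 * partial 3 (\<xi> 2) p)"
    "partial 2 (\<xi> 3) p - 2 * p $ 1 * partial 3 (\<xi> 3) p =
       - 2 * \<xi> 1 p + 2 * p $ 2 * (partial 2 (\<xi> 1) p - 2 * p $ 1 * partial 3 (\<xi> 1) p)
       - 2 * p $ 1 * (partial 2 (\<xi> 2) p - 2 * p $ 1 * partial 3 (\<xi> 2) p)"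
proof -
  have sym: "\<And>J. kohn_laplace_jet J = 0 \<Longrightarrow> prolong2 (affine_field \<xi> c b) kohn_laplace_jet J = 0"
    using assms by (auto simp: lie_point_symmetry_def)
  note prol = prolong2_affine_field[OF s]
  have xy: "jet_point J = (p, 0) \<Longrightarrow> jet_x i J = p $ i" "jet_point J = (p, 0) \<Longrightarrow> jet_u J = 0" for i J
    using fst_jet_point[of J] by auto
  have eq: "kohn_laplace b p
    + p1 * (2 * (partial 1 c p + 2 * p $ 2 * partial 3 c p) - kohn_laplace (\<xi> 1) p)
    + p2 * (2 * (partial 2 c p - 2 * p $ 1 * partial 3 c p) - kohn_laplace (\<xi> 2) p)
    - r11 * (2 * (partial 1 (\<xi> 1) p + 2 * p $ 2 * partial 3 (\<xi> 1) p))
    - r22 * (2 * (partial 2 (\<xi> 2) p - 2 * p $ 1 * partial 3 (\<xi> 2) p))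
    - r12 * (2 * (partial 1 (\<xi> 2) p + 2 * p $ 2 * partial 3 (\<xi> 2) p
        + partial 2 (\<xi> 1) p - 2 * p $ 1 * partial 3 (\<xi> 1) p))
    + r13 * (4 * \<xi> 2 p - 2 * (partial 1 (\<xi> 3) p + 2 * p $ 2 * partial 3 (\<xi> 3) p
        + 2 * p $ 2 * partial 1 (\<xi> 1) p - 2 * p $ 1 * partial 2 (\<xi> 1) p
        + 4 * ((p $ 1)^2 + (p $ 2)^2) * partial 3 (\<xi> 1) p))
    + r23 * (- 4 * \<xi> 1 p - 2 * (partial 2 (\<xi> 3) p - 2 * p $ 1 * partial 3 (\<xi> 3) p
        + 2 * p $ 2 * partial 1 (\<xi> 2) p - 2 * p $ 1 * partial 2 (\<xi> 2) p
        + 4 * ((p $ 1)^2 + (p $ 2)^2) * partial 3 (\<xi> 2) p)) = 0"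
    if r: "r11 + r22 + 4 * p $ 2 * r13 - 4 * p $ 1 * r23 = 0" for p1 p2 r11 r22 r12 r13 r23
  proof -
    obtain J where J: "jet_point J = (p, 0)" "jet_u1 1 J = p1" "jet_u1 2 J = p2" "jet_u1 3 J = 0"
      "jet_u2 1 1 J = r11" "jet_u2 2 2 J = r22" "jet_u2 3 3 J = 0"
      "jet_u2 1 2 J = r12" "jet_u2 1 3 J = r13" "jet_u2 2 3 J = r23" by (rule jet_exists)
    have "kohn_laplace_jet J = 0"
      using r by (simp add: kohn_laplace_jet_def J xy[OF J(1)])
    from sym[OF this] this show ?thesis
      by (simp add: prol J xy[OF J(1)])
  qed
  \<comment> \<open>In \<open>eq[of ...]\<close> the arguments are, in order, r11, r22, r13, r23,
    p1, p2, r12.\<close>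
  show b: "kohn_laplace b p = 0"
    using eq[of 0 0 0 0 0 0 0] by simp
  show "kohn_laplace (\<xi> 1) p = 2 * (partial 1 c p + 2 * p $ 2 * partial 3 c p)"
    using eq[of 0 0 0 0 1 0 0] b by simp
  show "kohn_laplace (\<xi> 2) p = 2 * (partial 2 c p - 2 * p $ 1 * partial 3 c p)"
    using eq[of 0 0 0 0 0 1 0] b by simp
  show 1: "partial 1 (\<xi> 1) p + 2 * p $ 2 * partial 3 (\<xi> 1) p = partial 2 (\<xi> 2) p - 2 * p $ 1 * partial 3 (\<xi> 2) p"
    using eq[of 1 "-1" 0 0 0 0 0] b by simp
  show 2: "partial 1 (\<xi> 2) p + 2 * p $ 2 * partial 3 (\<xi> 2) p = - (partial 2 (\<xi> 1) p - 2 * p $ 1 * partial 3 (\<xi> 1) p)"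
    using eq[of 0 0 0 0 0 0 1] b by simp
  show "partial 1 (\<xi> 3) p + 2 * p $ 2 * partial 3 (\<xi> 3) p =
       2 * \<xi> 2 p + 2 * p $ 2 * (partial 1 (\<xi> 1) p + 2 * p $ 2 * partial 3 (\<xi> 1) p)
       - 2 * p $ 1 * (partial 1 (\<xi> 2) p + 2 * p $ 2 * partial 3 (\<xi> 2) p)"
    \<comment> \<open>With u_13 = 1, the values u_11 = - 4 y and u_12 = 2 x make X X u, Y Y u and X
      Y u + Y X u vanish. The jet used for the next equation does the same with u_23 = 1.\<close>
    using eq[of "- 4 * p $ 2" 0 1 0 0 0 "2 * p $ 1"] b 2 by simp algebra
  show "partial 2 (\<xi> 3) p - 2 * p $ 1 * partial 3 (\<xi> 3) p =
       - 2 * \<xi> 1 p + 2 * p $ 2 * (partial 2 (\<xi> 1) p - 2 * p $ 1 * partial 3 (\<xi> 1) p)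
       - 2 * p $ 1 * (partial 2 (\<xi> 2) p - 2 * p $ 1 * partial 3 (\<xi> 2) p)"
    using eq[of 0 "4 * p $ 1" 0 1 0 0 "- 2 * p $ 2"] b 2 by simp algebra
qed

section \<open>The horizontal frame\<close>

definition hX :: "(real^3 \<Rightarrow> real) \<Rightarrow> real^3 \<Rightarrow> real" where
  "hX f p = partial 1 f p + 2 * p $ 2 * partial 3 f p"

definition hY :: "(real^3 \<Rightarrow> real) \<Rightarrow> real^3 \<Rightarrow> real" where
  "hY f p = partial 2 f p - 2 * p $ 1 * partial 3 f p"

lemma smooth_hX [simp, intro]: "smooth f \<Longrightarrow> smooth (hX f)"
  and smooth_hY [simp, intro]: "smooth f \<Longrightarrow> smooth (hY f)"
  unfolding hX_def[abs_def] hY_def[abs_def] by auto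

lemma hX_simps [simp]:
  "hX (\<lambda>p. k) = (\<lambda>p. 0)"
  "smooth f \<Longrightarrow> smooth g \<Longrightarrow> hX (\<lambda>p. f p + g p) = (\<lambda>p. hX f p + hX g p)"
  "smooth f \<Longrightarrow> smooth g \<Longrightarrow> hX (\<lambda>p. f p - g p) = (\<lambda>p. hX f p - hX g p)"
  "smooth f \<Longrightarrow> hX (\<lambda>p. - f p) = (\<lambda>p. - hX f p)"
  "smooth f \<Longrightarrow> smooth g \<Longrightarrow> hX (\<lambda>p. f p * g p) = (\<lambda>p. hX f p * g p + f p * hX g p)"
  "smooth f \<Longrightarrow> hX (\<lambda>p. f p ^ n) = (\<lambda>p. of_nat n * f p ^ (n - 1) * hX f p)"
  "hX (\<lambda>p. p $ i) = (\<lambda>p. if i = 1 then 1 else if i = 3 then 2 * p $ 2 else 0)"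
  by (auto simp: hX_def fun_eq_iff algebra_simps)

lemma hY_simps [simp]:
  "hY (\<lambda>p. k) = (\<lambda>p. 0)"
  "smooth f \<Longrightarrow> smooth g \<Longrightarrow> hY (\<lambda>p. f p + g p) = (\<lambda>p. hY f p + hY g p)"
  "smooth f \<Longrightarrow> smooth g \<Longrightarrow> hY (\<lambda>p. f p - g p) = (\<lambda>p. hY f p - hY g p)"
  "smooth f \<Longrightarrow> hY (\<lambda>p. - f p) = (\<lambda>p. - hY f p)"
  "smooth f \<Longrightarrow> smooth g \<Longrightarrow> hY (\<lambda>p. f p * g p) = (\<lambda>p. hY f p * g p + f p * hY g p)"
  "smooth f \<Longrightarrow> hY (\<lambda>p. f p ^ n) = (\<lambda>p. of_nat n * f p ^ (n - 1) * hY f p)"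
  "hY (\<lambda>p. p $ i) = (\<lambda>p. if i = 2 then 1 else if i = 3 then - 2 * p $ 1 else 0)"
  by (auto simp: hY_def fun_eq_iff algebra_simps)

lemma frame_commutators:
  assumes "smooth f"
  shows "hX (hY f) = (\<lambda>p. hY (hX f) p - 4 * partial 3 f p)"
    "partial 3 (hX f) = hX (partial 3 f)" "partial 3 (hY f) = hY (partial 3 f)"
  unfolding hX_def[abs_def] hY_def[abs_def]
  by (auto simp: assms partial_swap fun_eq_iff algebra_simps)

lemma kohn_laplace_frame:
  assumes "smooth f"
  shows "kohn_laplace f p = hX (hX f) p + hY (hY f) p"
  unfolding hX_def[abs_def] hY_def[abs_def] kohn_laplace_def
  by (simp add: assms partial_swap power2_eq_square algebra_simps)

text \<open>The frame is bracket generating.\<close>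

lemma horizontal_const:
  assumes f: "smooth f" and X: "\<And>p. hX f p = 0" and Y: "\<And>p. hY f p = 0"
  shows "f p = f 0"
proof (rule smooth_const_if_partials_zero[OF f])
  fix i p
  have "hX f = (\<lambda>p. 0)" "hY f = (\<lambda>p. 0)" using X Y by auto
  then have "partial 3 f p = 0" for p
    using fun_cong[OF frame_commutators(1)[OF f], of p] by simp
  then show "partial i f p = 0"
    using exhaust_3[of i] X[of p] Y[of p] by (auto simp: hX_def hY_def)
qed

text \<open>Counting t with weight 2, the eight initial values are derivatives of weights 0, 1, 1,
  2, 2, 3, 3, 4. Any further derivative of f reduces to these by the two equations and the
  commutator.\<close>

lemma contact_potential_rigid:
  assumes f: "smooth f"
    and 1: "hX (hX f) = hY (hY f)" and 2: "hX (hY f) = (\<lambda>p. - hY (hX f) p)"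
    and init: "f 0 = 0" "hX f 0 = 0" "hY f 0 = 0" "partial 3 f 0 = 0" "hX (hX f) 0 = 0"
      "hX (partial 3 f) 0 = 0" "hY (partial 3 f) 0 = 0" "partial 3 (partial 3 f) 0 = 0"
  shows "f = (\<lambda>p. 0)"
proof -
  define h g where "h = partial 3 f" and "g = hX (hX f)"
  note init = init[folded h_def g_def]
  have h: "smooth h" and g: "smooth g" by (auto simp: h_def g_def f)
  have YX: "hY (hX f) = (\<lambda>p. 2 * h p)" and XY: "hX (hY f) = (\<lambda>p. - 2 * h p)"
    using frame_commutators(1)[OF f] 2 by (auto simp: fun_eq_iff h_def)
  have T: "hX h = partial 3 (hX f)" "hY h = partial 3 (hY f)"
    using frame_commutators[OF f] by (auto simp: h_def)
  have Xg: "hX g = (\<lambda>p. - 6 * hY h p)"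
  proof -
    have "hX g = hX (hY (hY f))" by (simp add: g_def 1)
    also have "\<dots> = (\<lambda>p. hY (\<lambda>p. - 2 * h p) p - 4 * hY h p)"
      using frame_commutators(1)[of "hY f"] f by (simp add: XY T)
    also have "\<dots> = (\<lambda>p. - 6 * hY h p)" using h by simp
    finally show ?thesis .
  qed
  have Yg: "hY g = (\<lambda>p. 6 * hX h p)"
  proof -
    have "hY (hX (hX f)) = (\<lambda>p. hX (hY (hX f)) p + 4 * hX h p)"
      using frame_commutators(1)[of "hX f"] f by (simp add: T)
    also have "\<dots> = (\<lambda>p. 6 * hX h p)" using h by (simp add: YX)
    finally show ?thesis by (simp add: g_def)
  qed
  have XXh: "hX (hX h) = partial 3 g" and YYh: "hY (hY h) = partial 3 g"
    using frame_commutators[of "hX f"] frame_commutators[of "hY f"] f by (auto simp: T g_def 1)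
  have YXh: "hY (hX h) = (\<lambda>p. 2 * partial 3 h p)"
    using frame_commutators(3)[of "hX f"] f h by (simp add: T YX)
  have XYh: "hX (hY h) = (\<lambda>p. - 2 * partial 3 h p)"
    using frame_commutators(2)[of "hY f"] f h by (simp add: T XY)
  \<comment> \<open>Inserting \<open>Xg\<close> and \<open>Yg\<close>, the commutator reads 6 g_t =
    - 6 g_t - 4 g_t.\<close>
  have "hX (hY g) = (\<lambda>p. hY (hX g) p - 4 * partial 3 g p)" by (rule frame_commutators(1)[OF g])
  then have "partial 3 g p = 0" for p
    using h by (simp add: Xg Yg XXh YYh fun_eq_iff)
  then have XXh: "hX (hX h) = (\<lambda>p. 0)" and YYh: "hY (hY h) = (\<lambda>p. 0)"
    by (auto simp: XXh YYh)
  \<comment> \<open>The commutator applied to \<open>hX h\<close> reads 2 X h_t = - 4 X h_t, since X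
    X h = 0; similarly for Y below.\<close>
  have XTh: "hX (partial 3 h) p = 0" for p
    using fun_cong[OF frame_commutators(1)[of "hX h"], of p] frame_commutators(2)[OF h] h
    by (simp add: YXh XXh)
  have YTh: "hY (partial 3 h) p = 0" for p
    using fun_cong[OF frame_commutators(1)[of "hY h"], of p] frame_commutators(3)[OF h] h
    by (simp add: XYh YYh)
  \<comment> \<open>From here the weights are descended: the horizontal derivatives of each function
    are multiples of functions already shown to vanish, so the function is constant, and its initial
    value makes it zero.\<close>
  have "partial 3 h p = 0" for p
    using horizontal_const[of "partial 3 h"] XTh YTh h init by auto
  then have "hX h p = 0" "hY h p = 0" for p
    using horizontal_const[of "hX h"] horizontal_const[of "hY h"] h init
    by (auto simp: XXh YYh XYh YXh)
  then have "h p = 0" "g p = 0" for p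
    using horizontal_const[OF h] horizontal_const[OF g] init by (auto simp: Xg Yg)
  then have "hX f p = 0" "hY f p = 0" for p
    using horizontal_const[of "hX f"] horizontal_const[of "hY f"] f init
    by (auto simp: XY YX 1[symmetric] g_def[symmetric])
  then show ?thesis
    using horizontal_const[OF f] init by (auto simp: fun_eq_iff)
qed

text \<open>The coefficients of $T, R, \tilde X, \tilde Y, V_1, V_2, V_3$ and of $[T, V_1] = Z - U$ in a vector
  field, without its $W_\beta$ part, are \<open>a 1, \<dots>, a 8\<close>.\<close>

definition cr_xi :: "(nat \<Rightarrow> real) \<Rightarrow> 3 \<Rightarrow> real^3 \<Rightarrow> real" where
  "cr_xi a i = (\<lambda>p. let x = p $ 1; y = p $ 2; t = p $ 3 in
     if i = 1 then a 2 * y + a 3 + a 5 * (x * t - x^2 * y - y^3) + a 6 * (t - 4 * x * y)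
       + a 7 * (x^2 - 3 * y^2) + a 8 * x
     else if i = 2 then - a 2 * x + a 4 + a 5 * (y * t + x^3 + x * y^2) + a 6 * (3 * x^2 - y^2)
       + a 7 * (t + 4 * x * y) + a 8 * y
     else a 1 - 2 * a 3 * y + 2 * a 4 * x + a 5 * (t^2 - (x^2 + y^2)^2)
       - a 6 * (2 * y * t + 2 * x^3 + 2 * x * y^2) + a 7 * (2 * x * t - 2 * x^2 * y - 2 * y^3) + 2 * a 8 * t)"

text \<open>This is \<open>- hX (cr_xi a 1)\<close>, minus the conformal factor of the flow.\<close>

definition cr_c :: "(nat \<Rightarrow> real) \<Rightarrow> real^3 \<Rightarrow> real" where
  "cr_c a = (\<lambda>p. - a 5 * p $ 3 + 2 * a 6 * p $ 2 - 2 * a 7 * p $ 1 - a 8)"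

lemmas cr_xi_components = cr_xi_def[of _ 1, simplified Let_def] cr_xi_def[of _ 2, simplified Let_def]
  cr_xi_def[of _ 3, simplified Let_def]

lemma smooth_cr [simp]: "smooth (cr_xi a i)" "smooth (cr_c a)"
  using exhaust_3[of i] by (auto simp: cr_xi_def cr_c_def Let_def)

text \<open>The contact form dt - 2 y dx + 2 x dy evaluated on \<open>cr_xi a\<close>; the field is
  recovered from its horizontal derivatives.\<close>

definition contact_poly :: "(nat \<Rightarrow> real) \<Rightarrow> real^3 \<Rightarrow> real" where
  "contact_poly a = (\<lambda>p. let x = p $ 1; y = p $ 2; t = p $ 3; r = x^2 + y^2 in
     a 1 - 2 * a 2 * r - 4 * a 3 * y + 4 * a 4 * x + a 5 * (t^2 + r^2) - 4 * a 6 * (y * t - x * r)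
     + 4 * a 7 * (x * t + y * r) + 2 * a 8 * t)"

lemma smooth_contact_poly [simp]: "smooth (contact_poly a)"
  by (simp add: contact_poly_def Let_def)

lemma hX_contact_poly: "hX (contact_poly a) = (\<lambda>p. 4 * cr_xi a 2 p)"
  and hY_contact_poly: "hY (contact_poly a) = (\<lambda>p. - 4 * cr_xi a 1 p)"
  and contact_poly_cr: "cr_xi a 3 p - 2 * p $ 2 * cr_xi a 1 p + 2 * p $ 1 * cr_xi a 2 p = contact_poly a p"
  by (auto simp: contact_poly_def cr_xi_components Let_def fun_eq_iff power2_eq_square
      power3_eq_cube algebra_simps)

lemma contact_poly_eqs:
  "hX (hX (contact_poly a)) = hY (hY (contact_poly a))"
  "hX (hY (contact_poly a)) = (\<lambda>p. - hY (hX (contact_poly a)) p)"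
  unfolding hX_contact_poly hY_contact_poly
  by (auto simp: cr_xi_components fun_eq_iff power2_eq_square power3_eq_cube algebra_simps)

lemma contact_poly_at_0:
  "contact_poly a 0 = a 1" "cr_xi a 1 0 = a 3" "cr_xi a 2 0 = a 4" "hX (cr_xi a 2) 0 = - a 2"
  by (simp_all add: contact_poly_def cr_xi_components Let_def)

lemma contact_potential_poly:
  assumes f: "smooth f"
    and 1: "hX (hX f) = hY (hY f)" and 2: "hX (hY f) = (\<lambda>p. - hY (hX f) p)"
  obtains a where "f = contact_poly a"
proof -
  define h where "h = partial 3 f"
  \<comment> \<open>These values invert the Taylor data of \<open>contact_poly a\<close> at the
    origin: with f in its place, f = a 1, X X f = - 4 a 2, Y f = - 4 a 3, X f = 4 a 4, f_tt = 2 a 5,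
    Y f_t = - 4 a 6, X f_t = 4 a 7 and f_t = 2 a 8.\<close>
  define a :: "nat \<Rightarrow> real" where "a = (\<lambda>_. 0)(1 := f 0, 2 := - hX (hX f) 0 / 4, 3 := - hY f 0 / 4,
    4 := hX f 0 / 4, 5 := partial 3 h 0 / 2, 6 := - hY h 0 / 4, 7 := hX h 0 / 4, 8 := h 0 / 2)"
  define q where "q = (\<lambda>p. f p - contact_poly a p)"
  have "q = (\<lambda>p. 0)"
  proof (rule contact_potential_rigid)
    show "smooth q" by (simp add: q_def f)
    show "hX (hX q) = hY (hY q)" "hX (hY q) = (\<lambda>p. - hY (hX q) p)"
      using f 1 2 by (simp_all add: q_def contact_poly_eqs)
    have 3: "partial 3 (contact_poly a) = (\<lambda>p. 2 * a 5 * p $ 3 - 4 * a 6 * p $ 2 + 4 * a 7 * p $ 1 + 2 * a 8)"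
      by (simp add: contact_poly_def Let_def fun_eq_iff)
    show "q 0 = 0" "hX q 0 = 0" "hY q 0 = 0" "partial 3 q 0 = 0" "hX (hX q) 0 = 0"
      "hX (partial 3 q) 0 = 0" "hY (partial 3 q) 0 = 0" "partial 3 (partial 3 q) 0 = 0"
      using f by (simp_all add: q_def 3 hX_contact_poly hY_contact_poly contact_poly_at_0)
        (simp_all add: a_def h_def)
  qed
  then have "f = contact_poly a" by (auto simp: q_def fun_eq_iff)
  then show thesis by (rule that)
qed

text \<open>\<open>cr_c a\<close> solves the determining equations for c, so any other solution has
  the same horizontal derivatives and differs from it by a constant.\<close>

lemma cr_c_eqs:
  "kohn_laplace (cr_xi a 1) p = 2 * hX (cr_c a) p"
  "kohn_laplace (cr_xi a 2) p = 2 * hY (cr_c a) p"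
  by (simp_all add: kohn_laplace_frame)
    (simp_all add: cr_c_def cr_xi_components power2_eq_square power3_eq_cube algebra_simps)

lemma point_symmetry_classification:
  assumes "lie_point_symmetry S"
  obtains a k b where "S = affine_field (cr_xi a) (\<lambda>p. cr_c a p + k) b" "smooth b"
    "\<And>p. kohn_laplace b p = 0"
proof -
  obtain \<xi> c b where S: "S = affine_field \<xi> c b" and s: "\<And>i. smooth (\<xi> i)" "smooth c" "smooth b"
    using point_symmetry_affine[OF assms] by metis
  note eqs = determining_equations[OF assms[unfolded S] s, folded hX_def hY_def]
  define f where "f = (\<lambda>p. \<xi> 3 p - 2 * p $ 2 * \<xi> 1 p + 2 * p $ 1 * \<xi> 2 p)"
  have f: "smooth f" by (simp add: f_def s)
  have Xf: "hX f = (\<lambda>p. 4 * \<xi> 2 p)" and Yf: "hY f = (\<lambda>p. - 4 * \<xi> 1 p)"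
    by (simp_all add: f_def s eqs fun_eq_iff algebra_simps)
  have "hX (hX f) = hY (hY f)" "hX (hY f) = (\<lambda>p. - hY (hX f) p)"
    by (simp_all add: Xf Yf s eqs(4,5) fun_eq_iff)
  from contact_potential_poly[OF f this] obtain a where a: "f = contact_poly a" .
  have 12: "\<xi> 1 = cr_xi a 1" "\<xi> 2 = cr_xi a 2"
    using Xf Yf hX_contact_poly[of a] hY_contact_poly[of a] by (auto simp: a fun_eq_iff)
  have "\<xi> 3 = cr_xi a 3"
  proof
    fix p show "\<xi> 3 p = cr_xi a 3 p"
      using fun_cong[OF a, of p] contact_poly_cr[of a p] by (simp add: f_def 12)
  qed
  with 12 have "\<xi> i = cr_xi a i" for i
    using exhaust_3[of i] by auto
  then have \<xi>: "\<xi> = cr_xi a" by blast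
  have "c p - cr_c a p = c 0 - cr_c a 0" for p
    using eqs(2,3) cr_c_eqs[of a] s
    by (intro horizontal_const[where f = "\<lambda>p. c p - cr_c a p"]) (simp_all add: \<xi>)
  then have "c p = cr_c a p + (c 0 - cr_c a 0)" for p by (metis add.commute diff_add_cancel)
  then have "c = (\<lambda>p. cr_c a p + (c 0 - cr_c a 0))" by blast
  with S \<xi> have "S = affine_field (cr_xi a) (\<lambda>p. cr_c a p + (c 0 - cr_c a 0)) b" by simp
  from that[OF this s(3) eqs(1)] show thesis .
qed

lemma cr_point_symmetry:
  assumes b: "smooth b" "\<And>p. kohn_laplace b p = 0"
  shows "lie_point_symmetry (affine_field (cr_xi a) (cr_c a) b)"
  unfolding lie_point_symmetry_def
proof (intro conjI allI impI)
  show "smooth (affine_field (cr_xi a) (cr_c a) b)"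
    by (intro smooth_affine_field smooth_cr b)
  fix J assume J: "kohn_laplace_jet J = 0"
  define x y t where "x = jet_x 1 J" and "y = jet_x 2 J" and "t = jet_x 3 J"
  \<comment> \<open>Eliminating u_11 leaves a polynomial identity in free jet coordinates.\<close>
  have J': "jet_u2 1 1 J = - jet_u2 2 2 J - 4 * (x\<^sup>2 + y\<^sup>2) * jet_u2 3 3 J - 4 * y * jet_u2 1 3 J + 4 * x * jet_u2 2 3 J"
    using J by (simp add: kohn_laplace_jet_def x_def y_def)
  show "prolong2 (affine_field (cr_xi a) (cr_c a) b) kohn_laplace_jet J = 0"
    unfolding prolong2_affine_field[OF smooth_cr b(1)] J b(2) J'
    by (simp add: kohn_laplace_def cr_xi_components cr_c_def fst_jet_point x_def[symmetric] y_def[symmetric] t_def[symmetric])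
      algebra
qed

section \<open>The generated Lie algebra\<close>

abbreviation cr_field :: "(nat \<Rightarrow> real) \<Rightarrow> (real^3 \<Rightarrow> real) \<Rightarrow> vfield" where
  "cr_field a b \<equiv> affine_field (cr_xi a) (cr_c a) b"

lemma frechet_affine_field:
  assumes s: "\<And>i. smooth (\<xi> i)" "smooth c" "smooth b"
  shows "frechet_derivative (affine_field \<xi> c b) (at z) v =
    ((\<chi> i. \<Sum>j\<in>UNIV. fst v $ j * partial j (\<xi> i) (fst z)),
     (\<Sum>j\<in>UNIV. fst v $ j * partial j c (fst z)) * snd z + c (fst z) * snd v
     + (\<Sum>j\<in>UNIV. fst v $ j * partial j b (fst z)))"
proof -
  let ?S = "affine_field \<xi> c b"
  note D = smooth_has_derivative[OF smooth_affine_field[OF s], where x = z]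
  have comp: "frechet_derivative (\<lambda>z. L (?S z)) (at z) v = L (frechet_derivative ?S (at z) v)"
    if "bounded_linear L" for L :: "_ \<Rightarrow> real"
    by (rule fun_cong[OF frechet_derivative_at[OF bounded_linear.has_derivative[OF that D]], symmetric])
  have "fst (frechet_derivative ?S (at z) v) $ i = (\<Sum>j\<in>UNIV. fst v $ j * partial j (\<xi> i) (fst z))" for i
    using comp[OF bounded_linear_compose[OF bounded_linear_vec_nth[of i] bounded_linear_fst], symmetric]
    by (simp add: affine_field_def frechet_fst s frechet_partial)
  moreover
  have d: "((\<lambda>z. f (fst z)) has_derivative (\<lambda>v. frechet_derivative f (at (fst z)) (fst v))) (at z)"
    if "smooth f" for f :: "real^3 \<Rightarrow> real" and z :: "(real^3) \<times> real"
    using diff_chain_at[OF has_derivative_fst[OF has_derivative_ident] smooth_has_derivative[OF that]]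
    by (simp add: o_def)
  have "((\<lambda>z. c (fst z) * snd z + b (fst z)) has_derivative (\<lambda>v. c (fst z) * snd v
      + frechet_derivative c (at (fst z)) (fst v) * snd z + frechet_derivative b (at (fst z)) (fst v))) (at z)"
    by (intro has_derivative_add has_derivative_mult d s has_derivative_snd has_derivative_ident)
  from fun_cong[OF frechet_derivative_at[OF this], of v]
  have "snd (frechet_derivative ?S (at z) v) =
     (\<Sum>j\<in>UNIV. fst v $ j * partial j c (fst z)) * snd z + c (fst z) * snd v
     + (\<Sum>j\<in>UNIV. fst v $ j * partial j b (fst z))"
    using comp[OF bounded_linear_snd] by (simp add: affine_field_def frechet_partial s)
  ultimately show ?thesis by (simp add: prod_eq_iff vec_eq_iff)
qed

text \<open>The structure constants are read off from the Taylor coefficients of the bracket at the origin.\<close>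

definition cr_half_bracket :: "(nat \<Rightarrow> real) \<Rightarrow> (nat \<Rightarrow> real) \<Rightarrow> nat \<Rightarrow> real" where
  "cr_half_bracket a a' = (\<lambda>_. 0)(
     1 := 2 * a 3 * a' 4 - 2 * a 4 * a' 3 + 2 * a 1 * a' 8,
     2 := - 6 * a 3 * a' 6 - 6 * a 4 * a' 7,
     3 := a 3 * a' 8 + a 4 * a' 2 + a 1 * a' 6,
     4 := - a 3 * a' 2 + a 4 * a' 8 + a 1 * a' 7,
     5 := 2 * a 6 * a' 7 - 2 * a 7 * a' 6 + 2 * a 8 * a' 5,
     6 := - a 2 * a' 7 + a 8 * a' 6 + a 3 * a' 5,
     7 := a 8 * a' 7 + a 2 * a' 6 + a 4 * a' 5,
     8 := 2 * a 3 * a' 7 - 2 * a 4 * a' 6 + a 1 * a' 5)"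

definition cr_bracket :: "(nat \<Rightarrow> real) \<Rightarrow> (nat \<Rightarrow> real) \<Rightarrow> nat \<Rightarrow> real" where
  "cr_bracket a a' i = cr_half_bracket a a' i - cr_half_bracket a' a i"

lemma cr_bracket_xi:
  "(\<Sum>j\<in>UNIV. cr_xi a j p * partial j (cr_xi a' i) p) - (\<Sum>j\<in>UNIV. cr_xi a' j p * partial j (cr_xi a i) p)
    = cr_xi (cr_bracket a a') i p"
proof -
  obtain x y t where p: "p $ 1 = x" "p $ 2 = y" "p $ 3 = t" by blast
  note simps = sum_3 cr_xi_components cr_bracket_def cr_half_bracket_def p
  consider "i = 1" | "i = 2" | "i = 3" using exhaust_3 by blast
  then show ?thesis
  proof cases
    case 1
    then show ?thesis by (simp add: simps) (simp add: algebra_simps power2_eq_square power3_eq_cube)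
  next
    case 2
    then show ?thesis by (simp add: simps) (simp add: algebra_simps power2_eq_square power3_eq_cube)
  next
    case 3
    then show ?thesis by (simp add: simps) (simp add: algebra_simps power2_eq_square power3_eq_cube)
  qed
qed

lemma cr_bracket_c:
  "(\<Sum>j\<in>UNIV. cr_xi a j p * partial j (cr_c a') p) - (\<Sum>j\<in>UNIV. cr_xi a' j p * partial j (cr_c a) p)
    = cr_c (cr_bracket a a') p"
proof -
  obtain x y t where p: "p $ 1 = x" "p $ 2 = y" "p $ 3 = t" by blast
  show ?thesis
    by (simp add: sum_3 cr_xi_components cr_bracket_def cr_half_bracket_def cr_c_def p) algebra
qed

text \<open>The bracket of \<open>cr_field a (\<lambda>p. 0)\<close> with \<open>vf_W b\<close> is
  \<open>vf_W (cr_act a b)\<close>; the summand with \<open>cr_c\<close> comes from the bracket with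
  c u d/du.\<close>

definition cr_act :: "(nat \<Rightarrow> real) \<Rightarrow> (real^3 \<Rightarrow> real) \<Rightarrow> real^3 \<Rightarrow> real" where
  "cr_act a b p = (\<Sum>j\<in>UNIV. cr_xi a j p * partial j b p) - cr_c a p * b p"

lemma smooth_cr_act [simp]: "smooth b \<Longrightarrow> smooth (cr_act a b)"
  by (simp add: cr_act_def[abs_def] sum_3)

lemma kohn_laplace_linear:
  "smooth b \<Longrightarrow> smooth b' \<Longrightarrow> kohn_laplace (\<lambda>p. b p + b' p) p = kohn_laplace b p + kohn_laplace b' p"
  "smooth b \<Longrightarrow> smooth b' \<Longrightarrow> kohn_laplace (\<lambda>p. b p - b' p) p = kohn_laplace b p - kohn_laplace b' p"
  "smooth b \<Longrightarrow> kohn_laplace (\<lambda>p. k * b p) p = k * kohn_laplace b p"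
  "kohn_laplace (\<lambda>p. 0) p = 0"
  by (simp_all add: kohn_laplace_def algebra_simps)

lemma kohn_laplace_mult:
  assumes "smooth f" "smooth g"
  shows "kohn_laplace (\<lambda>p. f p * g p) p = f p * kohn_laplace g p + g p * kohn_laplace f p
    + 2 * (hX f p * hX g p + hY f p * hY g p)"
  using assms by (simp add: kohn_laplace_frame algebra_simps)

lemma cr_xi_frame:
  "hX (cr_xi a 1) p = hY (cr_xi a 2) p" "hX (cr_xi a 2) p = - hY (cr_xi a 1) p"
  using contact_poly_eqs[of a] by (simp_all add: hX_contact_poly hY_contact_poly fun_eq_iff)

text \<open>This keeps brackets with \<open>vf_W b\<close> inside the family: symmetries send
  solutions to solutions. In the frame the field is xi^1 X + xi^2 Y + f T with f the contact
  potential, and the second-order terms cancel by [\<Delta>, X] = 8 Y T, [\<Delta>, Y] = - 8 X T,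
  [\<Delta>, T] = 0 and the equations for \<open>cr_xi\<close> and \<open>cr_c\<close>.\<close>

lemma kohn_laplace_cr_act:
  assumes b: "smooth b" and harm: "\<And>p. kohn_laplace b p = 0"
  shows "kohn_laplace (cr_act a b) p = 0"
proof -
  define w where "w = partial 3 b"
  have w: "smooth w" by (simp add: w_def b)
  have act: "cr_act a b = (\<lambda>p. cr_xi a 1 p * hX b p + cr_xi a 2 p * hY b p + contact_poly a p * w p - cr_c a p * b p)"
    by (simp add: cr_act_def fun_eq_iff sum_3 w_def contact_poly_cr[symmetric] hX_def hY_def algebra_simps)
  have Yv: "hY (hY b) = (\<lambda>p. - hX (hX b) p)"
    using harm by (simp add: kohn_laplace_frame[OF b] fun_eq_iff add_eq_0_iff)
  have Xv: "hX (hY b) = (\<lambda>p. hY (hX b) p - 4 * w p)"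
    using frame_commutators(1)[OF b] by (simp add: w_def)
  have T: "partial 3 (hX b) = hX w" "partial 3 (hY b) = hY w"
    using frame_commutators[OF b] by (simp_all add: w_def)
  have klu: "kohn_laplace (hX b) p = 8 * hY w p" and klv: "kohn_laplace (hY b) p = - 8 * hX w p" for p
    using fun_cong[OF frame_commutators(1)[of "hX b"], of p] fun_cong[OF frame_commutators(1)[of "hY b"], of p] b w
    by (simp_all add: kohn_laplace_frame Yv Xv T)
  have "kohn_laplace w = partial 3 (kohn_laplace b)"
    by (simp add: kohn_laplace_def[abs_def] w_def b partial_swap)
  moreover have "kohn_laplace b = (\<lambda>p. 0)" using harm by auto
  ultimately have klw: "kohn_laplace w p = 0" by simp
  have klc: "kohn_laplace (cr_c a) p = 0"
    by (simp add: kohn_laplace_def cr_c_def)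
  have klf: "kohn_laplace (contact_poly a) p = - 8 * hY (cr_xi a 1) p"
    by (simp add: kohn_laplace_frame hX_contact_poly hY_contact_poly cr_xi_frame)
  show ?thesis
    unfolding act
    by (simp add: b w kohn_laplace_linear kohn_laplace_mult klu klv klw klc klf harm cr_c_eqs
        hX_contact_poly hY_contact_poly cr_xi_frame Xv Yv)
      (simp add: algebra_simps)
qed

lemma lie_bracket_cr_field:
  assumes b: "smooth b" "smooth b'"
  shows "lie_bracket (cr_field a b) (cr_field a' b') =
    cr_field (cr_bracket a a') (\<lambda>p. cr_act a b' p - cr_act a' b p)"
  unfolding lie_bracket_def frechet_affine_field[OF smooth_cr b(1)] frechet_affine_field[OF smooth_cr b(2)]
  by (simp add: affine_field_def fun_eq_iff vec_eq_iff cr_bracket_xi[symmetric] cr_bracket_c[symmetric] cr_act_def)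
    (simp add: algebra_simps)

lemma cr_field_add:
  "(\<lambda>z. cr_field a b z + cr_field a' b' z) = cr_field (\<lambda>i. a i + a' i) (\<lambda>p. b p + b' p)"
proof -
  have "cr_xi a i p + cr_xi a' i p = cr_xi (\<lambda>i. a i + a' i) i p" for i p
    using exhaust_3[of i] by (auto simp: cr_xi_components algebra_simps)
  then show ?thesis
    by (simp add: affine_field_def fun_eq_iff vec_eq_iff) (simp add: cr_c_def algebra_simps)
qed

lemma cr_field_scale: "(\<lambda>z. k *\<^sub>R cr_field a b z) = cr_field (\<lambda>i. k * a i) (\<lambda>p. k * b p)"
proof -
  have "k * cr_xi a i p = cr_xi (\<lambda>i. k * a i) i p" for i p
    using exhaust_3[of i] by (auto simp: cr_xi_components algebra_simps)
  then show ?thesis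
    by (simp add: affine_field_def fun_eq_iff vec_eq_iff) (simp add: cr_c_def algebra_simps)
qed

section \<open>Generators and the family that they generate\<close>

definition unit_coeff :: "nat \<Rightarrow> nat \<Rightarrow> real" where
  "unit_coeff i j = (if i = j then 1 else 0)"

lemma generators_cr_field:
  "vf_T = cr_field (unit_coeff 1) (\<lambda>p. 0)" "vf_R = cr_field (unit_coeff 2) (\<lambda>p. 0)"
  "vf_X = cr_field (unit_coeff 3) (\<lambda>p. 0)" "vf_Y = cr_field (unit_coeff 4) (\<lambda>p. 0)"
  "vf_V1 = cr_field (unit_coeff 5) (\<lambda>p. 0)" "vf_V2 = cr_field (unit_coeff 6) (\<lambda>p. 0)"
  "vf_V3 = cr_field (unit_coeff 7) (\<lambda>p. 0)" "vf_W \<beta> = cr_field (\<lambda>i. 0) \<beta>"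
  by (simp_all add: vf_T_def vf_R_def vf_X_def vf_Y_def vf_V1_def vf_V2_def vf_V3_def vf_W_def
      affine_field_def fun_eq_iff vec_eq_iff forall_3 cr_xi_components cr_c_def unit_coeff_def Let_def)

lemma lie_generated_eq:
  "lie_generated ({vf_T, vf_R, vf_X, vf_Y, vf_V1, vf_V2, vf_V3} \<union>
      {vf_W \<beta> | \<beta>. smooth \<beta> \<and> (\<forall>p. kohn_laplace \<beta> p = 0)}) =
   {cr_field a b | a b. smooth b \<and> (\<forall>p. kohn_laplace b p = 0)}" (is "lie_generated ?G = ?K")
proof (intro set_eqI iffI)
  fix S assume "S \<in> lie_generated ?G"
  then show "S \<in> ?K"
  proof induction
    case (generator A)
    then show ?case
      unfolding generators_cr_field using kohn_laplace_linear(4) by auto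
  next
    case zero
    have "(\<lambda>z. 0) = cr_field (\<lambda>i. 0) (\<lambda>p. 0)"
      using generators_cr_field(8)[of "\<lambda>p. 0"] by (simp add: vf_W_def fun_eq_iff zero_prod_def)
    then show ?case using kohn_laplace_linear(4) by fastforce
  next
    case (add A B)
    then obtain a b a' b' where "A = cr_field a b" "B = cr_field a' b'" and
      s: "smooth b" "smooth b'" "\<forall>p. kohn_laplace b p = 0" "\<forall>p. kohn_laplace b' p = 0"
      by auto
    then have "(\<lambda>z. A z + B z) = cr_field (\<lambda>i. a i + a' i) (\<lambda>p. b p + b' p)"
      by (simp add: cr_field_add)
    moreover have "smooth (\<lambda>p. b p + b' p)" "\<forall>p. kohn_laplace (\<lambda>p. b p + b' p) p = 0"
      using s by (auto simp: kohn_laplace_linear)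
    ultimately show ?case by blast
  next
    case (scale A k)
    then obtain a b where "A = cr_field a b" and s: "smooth b" "\<forall>p. kohn_laplace b p = 0"
      by auto
    then have "(\<lambda>z. k *\<^sub>R A z) = cr_field (\<lambda>i. k * a i) (\<lambda>p. k * b p)"
      by (simp add: cr_field_scale)
    moreover have "smooth (\<lambda>p. k * b p)" "\<forall>p. kohn_laplace (\<lambda>p. k * b p) p = 0"
      using s by (auto simp: kohn_laplace_linear)
    ultimately show ?case by blast
  next
    case (bracket A B)
    then obtain a b a' b' where "A = cr_field a b" "B = cr_field a' b'" and
      s: "smooth b" "smooth b'" "\<forall>p. kohn_laplace b p = 0" "\<forall>p. kohn_laplace b' p = 0"
      by auto
    then have "lie_bracket A B = cr_field (cr_bracket a a') (\<lambda>p. cr_act a b' p - cr_act a' b p)"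
      by (simp add: lie_bracket_cr_field)
    moreover have "smooth (\<lambda>p. cr_act a b' p - cr_act a' b p)"
      "\<forall>p. kohn_laplace (\<lambda>p. cr_act a b' p - cr_act a' b p) p = 0"
      using s by (auto simp: kohn_laplace_linear kohn_laplace_cr_act)
    ultimately show ?case by blast
  qed
next
  fix S assume "S \<in> ?K"
  then obtain a b where S: "S = cr_field a b" and b: "smooth b" "\<forall>p. kohn_laplace b p = 0" by auto
  have gen: "cr_field (unit_coeff i) (\<lambda>p. 0) \<in> lie_generated ?G" if "i \<in> {1, 2, 3, 4, 5, 6, 7}" for i
    using that generators_cr_field(1-7)[symmetric] by (auto intro!: lie_generated.generator)
  \<comment> \<open>The eighth basis field is not among the generators and is reached only through
    this bracket.\<close>
  have "cr_bracket (unit_coeff 1) (unit_coeff 5) = unit_coeff 8"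
    by (auto simp: cr_bracket_def cr_half_bracket_def unit_coeff_def fun_eq_iff)
  moreover have "cr_act a (\<lambda>p. 0) p = 0" for a p by (simp add: cr_act_def)
  ultimately have "lie_bracket (cr_field (unit_coeff 1) (\<lambda>p. 0)) (cr_field (unit_coeff 5) (\<lambda>p. 0)) = cr_field (unit_coeff 8) (\<lambda>p. 0)"
    by (simp add: lie_bracket_cr_field)
  then have 8: "cr_field (unit_coeff 8) (\<lambda>p. 0) \<in> lie_generated ?G"
    using lie_generated.bracket[OF gen[of 1] gen[of 5]] by simp
  have lin: "cr_field (\<lambda>j. \<Sum>i\<in>I. a i * unit_coeff i j) b \<in> lie_generated ?G" if "finite I" "I \<subseteq> {1, 2, 3, 4, 5, 6, 7, 8}" for I
    using that
  proof induction
    case empty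
    \<comment> \<open>The empty sum is \<open>vf_W b\<close>: the harmonic part enters at the base
      of the induction, and each later step adds a field with harmonic part 0.\<close>
    have "cr_field (\<lambda>i. 0) b \<in> lie_generated ?G"
      unfolding generators_cr_field(8)[symmetric] using b by (intro lie_generated.generator) auto
    then show ?case by simp
  next
    case (insert i I)
    have "cr_field (unit_coeff i) (\<lambda>p. 0) \<in> lie_generated ?G"
      using insert.prems gen[of i] 8 by auto
    note scaled = lie_generated.scale[OF this, of "a i", unfolded cr_field_scale]
    have "cr_field (\<lambda>j. \<Sum>i\<in>I. a i * unit_coeff i j) b \<in> lie_generated ?G"
      using insert by blast
    from lie_generated.add[OF scaled this, unfolded cr_field_add]
    show ?case using insert.hyps by simp
  qed
  \<comment> \<open>The two coefficient sequences may differ outside 1 to 8, but the field reads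
    only these entries.\<close>
  have "cr_field (\<lambda>j. \<Sum>i\<in>{1, 2, 3, 4, 5, 6, 7, 8}. a i * unit_coeff i j) b = cr_field a b"
    by (simp add: affine_field_def fun_eq_iff vec_eq_iff forall_3 cr_xi_components cr_c_def unit_coeff_def)
  then show "S \<in> lie_generated ?G"
    using lin[of "{1, 2, 3, 4, 5, 6, 7, 8}"] by (simp add: S)
qed

section \<open>The Lagrangian is not a total divergence\<close>

lemma tendsto_coordinatewise:
  fixes K :: "'a \<Rightarrow> 'b \<Rightarrow> 'c::topological_space"
  assumes "\<And>c. ((\<lambda>s. K s c) \<longlongrightarrow> L c) F"
  shows "(K \<longlongrightarrow> L) F"
  using assms limitin_componentwise[of "\<lambda>_. euclidean" UNIV K L F]
  by (simp add: euclidean_product_topology limitin_canonical_iff)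

lemma jet_mvt:
  assumes F: "jet_differentiable F"
  obtains \<theta> where "\<bar>\<theta> - a\<bar> \<le> \<bar>b - a\<bar>"
    "F (J(c := b)) - F (J(c := a)) = (b - a) * pd c F (J(c := \<theta>))"
proof -
  have D: "((\<lambda>r. F (J(c := r))) has_real_derivative pd c F (J(c := r))) (at r)" for r
    using jet_differentiableD(1)[OF F, of "J(c := r)" c] by simp
  consider "a < b" | "b < a" | "a = b" by linarith
  then show thesis
  proof cases
    case 1
    from MVT2[OF 1 D] obtain \<theta> where "a < \<theta>" "\<theta> < b"
      "F (J(c := b)) - F (J(c := a)) = (b - a) * pd c F (J(c := \<theta>))" by blast
    then show ?thesis by (intro that[of \<theta>]) auto
  next
    case 2
    from MVT2[OF 2 D] obtain \<theta> where "b < \<theta>" "\<theta> < a"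
      "F (J(c := a)) - F (J(c := b)) = (a - b) * pd c F (J(c := \<theta>))" by blast
    then show ?thesis by (intro that[of \<theta>]) (auto simp: algebra_simps)
  next
    case 3
    then show ?thesis by (intro that[of a]) auto
  qed
qed

text \<open>The chain rule, by moving one coordinate at a time.\<close>

lemma jet_chain_override:
  assumes F: "jet_differentiable F" and cont: "\<And>c. continuous_on UNIV (pd c F)"
    and \<gamma>: "\<And>c. ((\<lambda>s. \<gamma> s c) has_real_derivative \<gamma>' c) (at s0)"
    and "finite C"
  shows "((\<lambda>s. F (override_on (\<gamma> s0) (\<gamma> s) C)) has_real_derivative
    (\<Sum>c\<in>C. \<gamma>' c * pd c F (\<gamma> s0))) (at s0)"
  using \<open>finite C\<close>
proof induction
  case empty
  then show ?case by simp
next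
  case (insert c C)
  define J where "J s = override_on (\<gamma> s0) (\<gamma> s) C" for s
  have J0: "J s0 = \<gamma> s0" by (auto simp: J_def override_on_def)
  have J1: "J s = (J s)(c := \<gamma> s0 c)" for s
    using insert.hyps by (auto simp: J_def override_on_def)
  have J2: "override_on (\<gamma> s0) (\<gamma> s) (insert c C) = (J s)(c := \<gamma> s c)" for s
    by (auto simp: J_def override_on_def)
  \<comment> \<open>The increment from releasing coordinate \<open>c\<close>, which
    \<open>J s\<close> still holds at its value at \<open>s0\<close>. The mean value point is
    squeezed towards that value, so continuity of \<open>pd c F\<close> in the product topology
    sends the difference quotient to the partial at \<open>\<gamma> s0\<close>.\<close>
  define \<Delta> where "\<Delta> s = F ((J s)(c := \<gamma> s c)) - F (J s)" for s
  have "\<exists>\<theta>. \<bar>\<theta> - \<gamma> s0 c\<bar> \<le> \<bar>\<gamma> s c - \<gamma> s0 c\<bar> \<and>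
      \<Delta> s = (\<gamma> s c - \<gamma> s0 c) * pd c F ((J s)(c := \<theta>))" for s
    using jet_mvt[OF F, of "\<gamma> s0 c" "\<gamma> s c" "J s" c] J1[of s] unfolding \<Delta>_def by metis
  then obtain \<theta> where \<theta>: "\<And>s. \<bar>\<theta> s - \<gamma> s0 c\<bar> \<le> \<bar>\<gamma> s c - \<gamma> s0 c\<bar>"
    "\<And>s. \<Delta> s = (\<gamma> s c - \<gamma> s0 c) * pd c F ((J s)(c := \<theta> s))"
    by metis
  have lim\<gamma>: "((\<lambda>s. \<gamma> s d) \<longlongrightarrow> \<gamma> s0 d) (at s0)" for d
    using DERIV_isCont[OF \<gamma>] by (simp add: isCont_def)
  have "((\<lambda>s. \<theta> s - \<gamma> s0 c) \<longlongrightarrow> 0) (at s0)"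
    by (rule Lim_null_comparison[of _ "\<lambda>s. \<bar>\<gamma> s c - \<gamma> s0 c\<bar>"])
      (use \<theta>(1) lim\<gamma>[of c] in \<open>auto intro!: tendsto_rabs_zero simp: LIM_zero\<close>)
  then have lim\<theta>: "(\<theta> \<longlongrightarrow> \<gamma> s0 c) (at s0)" by (rule LIM_zero_cancel)
  have "((\<lambda>s. ((J s)(c := \<theta> s)) d) \<longlongrightarrow> \<gamma> s0 d) (at s0)" for d
    using lim\<theta> lim\<gamma>[of d] by (cases "d = c"; cases "d \<in> C") (auto simp: J_def override_on_def)
  then have "((\<lambda>s. (J s)(c := \<theta> s)) \<longlongrightarrow> \<gamma> s0) (at s0)"
    by (rule tendsto_coordinatewise)
  then have "((\<lambda>s. pd c F ((J s)(c := \<theta> s))) \<longlongrightarrow> pd c F (\<gamma> s0)) (at s0)"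
    by (rule continuous_on_tendsto_compose[OF cont]) auto
  moreover have "((\<lambda>s. (\<gamma> s c - \<gamma> s0 c) / (s - s0)) \<longlongrightarrow> \<gamma>' c) (at s0)"
    using \<gamma>[of c] by (simp add: has_field_derivative_iff)
  ultimately have "((\<lambda>s. (\<gamma> s c - \<gamma> s0 c) / (s - s0) * pd c F ((J s)(c := \<theta> s))) \<longlongrightarrow>
      \<gamma>' c * pd c F (\<gamma> s0)) (at s0)"
    by (rule tendsto_mult[rotated])
  moreover have "\<Delta> s0 = 0" using J0 by (simp add: \<Delta>_def)
  ultimately have "(\<Delta> has_real_derivative \<gamma>' c * pd c F (\<gamma> s0)) (at s0)"
    by (simp add: has_field_derivative_iff \<theta>(2))
  from DERIV_add[OF this insert.IH]
  have "((\<lambda>s. \<Delta> s + F (J s)) has_real_derivative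
      \<gamma>' c * pd c F (\<gamma> s0) + (\<Sum>c\<in>C. \<gamma>' c * pd c F (\<gamma> s0))) (at s0)"
    by (simp add: J_def)
  moreover have "F (override_on (\<gamma> s0) (\<gamma> s) (insert c C)) = \<Delta> s + F (J s)" for s
    unfolding J2 \<Delta>_def by simp
  ultimately show ?case by (simp only: sum.insert[OF insert.hyps])
qed

section \<open>Functions of finite order and total derivatives along curves\<close>

lemma finite_multi_index: "finite {\<alpha>::nat^3. (\<Sum>i\<in>UNIV. \<alpha> $ i) \<le> n}"
proof (rule finite_imageD)
  show "finite ((\<lambda>\<alpha>. (\<alpha> $ 1, \<alpha> $ 2, \<alpha> $ 3)) ` {\<alpha>::nat^3. (\<Sum>i\<in>UNIV. \<alpha> $ i) \<le> n})"
    by (rule finite_subset[of _ "{..n} \<times> {..n} \<times> {..n}"]) (auto simp: sum_3)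
  show "inj_on (\<lambda>\<alpha>. (\<alpha> $ 1, \<alpha> $ 2, \<alpha> $ 3)) {\<alpha>::nat^3. (\<Sum>i\<in>UNIV. \<alpha> $ i) \<le> n}"
    by (auto simp: inj_on_def vec_eq_iff forall_3)
qed

text \<open>What the chain rule needs. The order is an explicit parameter because it fixes how flat
  the bump must be at the boundary of the cube.\<close>

definition jet_C1 :: "nat \<Rightarrow> (jet \<Rightarrow> real) \<Rightarrow> bool" where
  "jet_C1 n F \<longleftrightarrow> order_le n F \<and> jet_differentiable F \<and> continuous_on UNIV F \<and>
     (\<forall>c. continuous_on UNIV (pd c F))"

lemma order_le_pd:
  assumes "order_le n F" "(\<Sum>i\<in>UNIV. \<alpha> $ i) > n"
  shows "pd (Deriv \<alpha>) F J = 0"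
proof -
  have "F (J(Deriv \<alpha> := s)) = F J" for s
    using assms unfolding order_le_def by (auto simp: not_le)
  then show ?thesis by (simp add: pd_def)
qed

lemma order_le_mono: "order_le n F \<Longrightarrow> n \<le> m \<Longrightarrow> order_le m F"
  unfolding order_le_def by (meson le_trans)

text \<open>Stated for all larger orders so that several functions can be given a common
  one.\<close>

lemma differential_function_jet_C1:
  assumes "differential_function F"
  obtains n where "\<And>m. n \<le> m \<Longrightarrow> jet_C1 m F"
proof -
  obtain n where n: "order_le n F" and k: "jet_Ck k F" for k
    using assms by (auto simp: differential_function_def)
  have "{\<alpha>. pd (Deriv \<alpha>) F J \<noteq> 0} \<subseteq> {\<alpha>. (\<Sum>i\<in>UNIV. \<alpha> $ i) \<le> n}" for J
    using order_le_pd[OF n] by (auto simp: not_le[symmetric])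
  then have "finite {\<alpha>. pd (Deriv \<alpha>) F J \<noteq> 0}" for J
    using finite_multi_index finite_subset by blast
  then have "jet_differentiable F"
    using k[of 1] by (auto simp: jet_differentiable_def)
  then show thesis
    using k[of 1] order_le_mono[OF n] by (intro that[of n]) (auto simp: jet_C1_def)
qed

lemma jet_C1_diff:
  assumes F: "jet_C1 n F" and G: "jet_C1 n G"
  shows "jet_C1 n (\<lambda>J. F J - G J)"
proof -
  have "order_le n (\<lambda>J. F J - G J)"
    unfolding order_le_def
  proof (intro allI impI)
    fix J J' :: jet
    assume *: "\<forall>i. J (Indep i) = J' (Indep i)"
      "\<forall>\<alpha>. (\<Sum>i\<in>UNIV. \<alpha> $ i) \<le> n \<longrightarrow> J (Deriv \<alpha>) = J' (Deriv \<alpha>)"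
    have "F J = F J'" "G J = G J'"
      using F G * unfolding jet_C1_def order_le_def by blast+
    then show "F J - G J = F J' - G J'" by simp
  qed
  then show ?thesis using F G by (simp add: jet_C1_def continuous_on_diff)
qed

lemma jet_C1_total_deriv:
  assumes "jet_C1 n F"
  shows "total_deriv i F J = pd (Indep i) F J +
    (\<Sum>\<alpha> | (\<Sum>i\<in>UNIV. \<alpha> $ i) \<le> n. J (Deriv (\<alpha> + axis i 1)) * pd (Deriv \<alpha>) F J)"
  using assms order_le_pd[of n F] by (intro total_deriv_eq finite_multi_index) (auto simp: jet_C1_def not_le)

lemma continuous_total_deriv:
  assumes "jet_C1 n F"
  shows "continuous_on UNIV (total_deriv i F)"
proof -
  have "total_deriv i F = (\<lambda>J. pd (Indep i) F J +
    (\<Sum>\<alpha> | (\<Sum>i\<in>UNIV. \<alpha> $ i) \<le> n. J (Deriv (\<alpha> + axis i 1)) * pd (Deriv \<alpha>) F J))"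
    using jet_C1_total_deriv[OF assms] by blast
  then show ?thesis
    using assms by (auto simp: jet_C1_def intro!: continuous_intros)
qed

text \<open>The hypotheses make the curve tangent to the contact distribution of jet space in
  direction i. The jets of a function along a line parallel to the i-th axis form such a
  curve.\<close>

lemma total_deriv_chain:
  assumes F: "jet_C1 n F"
    and I: "\<And>j. ((\<lambda>s. \<gamma> s (Indep j)) has_real_derivative (if j = i then 1 else 0)) (at s0)"
    and D: "\<And>\<alpha>. ((\<lambda>s. \<gamma> s (Deriv \<alpha>)) has_real_derivative \<gamma> s0 (Deriv (\<alpha> + axis i 1))) (at s0)"
  shows "((\<lambda>s. F (\<gamma> s)) has_real_derivative total_deriv i F (\<gamma> s0)) (at s0)"
proof -
  define N :: "(nat^3) set" where "N = {\<alpha>. (\<Sum>i\<in>UNIV. \<alpha> $ i) \<le> n}"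
  define C where "C = range Indep \<union> Deriv ` N"
  define \<gamma>' where "\<gamma>' c = (case c of Indep j \<Rightarrow> if j = i then 1 else 0 | Deriv \<alpha> \<Rightarrow> \<gamma> s0 (Deriv (\<alpha> + axis i 1)))" for c
  have \<gamma>': "((\<lambda>s. \<gamma> s c) has_real_derivative \<gamma>' c) (at s0)" for c
    using I D by (cases c) (simp_all add: \<gamma>'_def)
  have N: "finite N" unfolding N_def by (rule finite_multi_index)
  then have C: "finite C" by (simp add: C_def)
  \<comment> \<open>\<open>C\<close> contains every coordinate on which a function of order
    \<open>n\<close> can depend, so freezing the others changes nothing and finitely many
    coordinates suffice.\<close>
  have "F (override_on (\<gamma> s0) (\<gamma> s) C) = F (\<gamma> s)" for s
    using F unfolding jet_C1_def order_le_def by (auto simp: C_def N_def override_on_def)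
  then have "((\<lambda>s. F (\<gamma> s)) has_real_derivative (\<Sum>c\<in>C. \<gamma>' c * pd c F (\<gamma> s0))) (at s0)"
    using jet_chain_override[where F = F and \<gamma> = \<gamma> and \<gamma>' = \<gamma>' and C = C and ?s0.0 = s0] F \<gamma>' C
    by (simp add: jet_C1_def)
  also have "(\<Sum>c\<in>C. \<gamma>' c * pd c F (\<gamma> s0)) =
      (\<Sum>c\<in>range Indep. \<gamma>' c * pd c F (\<gamma> s0)) + (\<Sum>c\<in>Deriv ` N. \<gamma>' c * pd c F (\<gamma> s0))"
    unfolding C_def using N by (intro sum.union_disjoint) auto
  also have "\<dots> = total_deriv i F (\<gamma> s0)"
    unfolding jet_C1_total_deriv[OF F] N_def[symmetric]
    by (simp add: sum.reindex inj_on_def \<gamma>'_def if_distrib[of "\<lambda>x. x * _"] cong: if_cong)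
  finally show ?thesis .
qed

text \<open>By Fubini each summand may be integrated first in its own variable, where the integral
  is 0. A continuous nonnegative function on the cube with integral 0 vanishes there.\<close>

lemma divergence_cube:
  fixes D1 D2 D3 :: "real \<Rightarrow> real \<Rightarrow> real \<Rightarrow> real"
  assumes cont: "continuous_on UNIV (\<lambda>(x, y, t). D1 x y t)" "continuous_on UNIV (\<lambda>(x, y, t). D2 x y t)"
      "continuous_on UNIV (\<lambda>(x, y, t). D3 x y t)"
    and 1: "\<And>y t. integral {0..1} (\<lambda>x. D1 x y t) = 0"
    and 2: "\<And>x t. integral {0..1} (\<lambda>y. D2 x y t) = 0"
    and 3: "\<And>x y. integral {0..1} (\<lambda>t. D3 x y t) = 0"
    and nonneg: "\<And>x y t. 0 \<le> D1 x y t + D2 x y t + D3 x y t"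
    and xyt: "x \<in> {0..1}" "y \<in> {0..1}" "t \<in> {0..1}"
  shows "D1 x y t + D2 x y t + D3 x y t = 0"
proof -
  let ?I = "cbox (0, 0, 0) (1, 1, 1) :: (real \<times> real \<times> real) set"
  have int: "integral ?I (\<lambda>(x, y, t). D x y t) =
      integral (cbox 0 1) (\<lambda>x. integral (cbox 0 1) (\<lambda>y. integral (cbox 0 1) (\<lambda>t. D x y t)))"
    and cy: "continuous_on S (\<lambda>(y, t). D x y t)" and cx: "continuous_on T (\<lambda>(x, z). D x (fst z) (snd z))"
    if D: "continuous_on UNIV (\<lambda>(x, y, t). D x y t)" for D :: "real \<Rightarrow> real \<Rightarrow> real \<Rightarrow> real" and x S T
  proof -
    show cy: "continuous_on S (\<lambda>(y, t). D x y t)" for x S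
    proof -
      have "continuous_on S ((\<lambda>(x, y, t). D x y t) \<circ> (\<lambda>z. (x, fst z, snd z)))"
        by (intro continuous_on_compose continuous_on_subset[OF D] continuous_intros) auto
      then show ?thesis by (simp add: o_def split_def)
    qed
    show "continuous_on T (\<lambda>(x, z). D x (fst z) (snd z))"
      using continuous_on_subset[OF D, of T] by (simp add: split_def)
    have "integral ?I (\<lambda>(x, y, t). D x y t) =
      integral (cbox 0 1) (\<lambda>x. integral (cbox (0, 0) (1, 1)) (\<lambda>(y, t). D x y t))"
      using integral_prod_continuous[of 0 "(0, 0)" 1 "(1, 1)" "\<lambda>(x, y, t). D x y t"] D
      by (simp add: continuous_on_subset split_def)
    also have "\<dots> = integral (cbox 0 1) (\<lambda>x. integral (cbox 0 1) (\<lambda>y. integral (cbox 0 1) (\<lambda>t. D x y t)))"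
      using integral_prod_continuous[OF cy] by simp
    finally show "integral ?I (\<lambda>(x, y, t). D x y t) =
      integral (cbox 0 1) (\<lambda>x. integral (cbox 0 1) (\<lambda>y. integral (cbox 0 1) (\<lambda>t. D x y t)))" .
  qed
  have i3: "integral ?I (\<lambda>(x, y, t). D3 x y t) = 0"
    using int[OF cont(3)] 3 by simp
  have i2: "integral ?I (\<lambda>(x, y, t). D2 x y t) = 0"
  proof -
    have "integral (cbox 0 1) (\<lambda>y. integral (cbox 0 1) (\<lambda>t. D2 x y t)) =
        integral (cbox 0 1) (\<lambda>t. integral (cbox 0 1) (\<lambda>y. D2 x y t))" for x
      by (rule integral_swap_continuous[OF cy[OF cont(2)]])
    then have "integral (cbox 0 1) (\<lambda>y. integral (cbox 0 1) (\<lambda>t. D2 x y t)) = 0" for x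
      using 2 by simp
    then show ?thesis using int[OF cont(2)] by simp
  qed
  have i1: "integral ?I (\<lambda>(x, y, t). D1 x y t) = 0"
  proof -
    have "integral ?I (\<lambda>(x, y, t). D1 x y t) = integral (cbox 0 1) (\<lambda>x. integral (cbox (0, 0) (1, 1)) (\<lambda>z. D1 x (fst z) (snd z)))"
      using integral_prod_continuous[of 0 "(0, 0)" 1 "(1, 1)" "\<lambda>(x, y, t). D1 x y t"] cont(1)
      by (simp add: continuous_on_subset split_def)
    also have "\<dots> = integral (cbox (0, 0) (1, 1)) (\<lambda>z. integral (cbox 0 1) (\<lambda>x. D1 x (fst z) (snd z)))"
      by (rule integral_swap_continuous[OF cx[OF cont(1)]])
    also have "\<dots> = 0" using 1 by simp
    finally show ?thesis .
  qed
  let ?G = "\<lambda>(x, y, t). D1 x y t + D2 x y t + D3 x y t"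
  have ig: "(\<lambda>(x, y, t). D x y t) integrable_on ?I" if "continuous_on UNIV (\<lambda>(x, y, t). D x y t)"
    for D :: "real \<Rightarrow> real \<Rightarrow> real \<Rightarrow> real"
    by (rule integrable_continuous[OF continuous_on_subset[OF that]]) simp
  have "?G = (\<lambda>z. (case z of (x, y, t) \<Rightarrow> D1 x y t) + (case z of (x, y, t) \<Rightarrow> D2 x y t)
      + (case z of (x, y, t) \<Rightarrow> D3 x y t))" by auto
  moreover have "continuous_on UNIV \<dots>" by (intro continuous_on_add cont)
  moreover have "integral ?I \<dots> = 0"
    using cont by (simp add: Henstock_Kurzweil_Integration.integral_add integrable_add ig i1 i2 i3)
  ultimately have "continuous_on ?I ?G" "integral ?I ?G = 0"
    using continuous_on_subset by auto
  then have "\<forall>z\<in>?I. ?G z = 0"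
    using nonneg by (subst (asm) integral_cbox_eq_0_iff) (auto simp: box_ne_empty Basis_prod_def)
  from bspec[OF this, of "(x, y, t)"] xyt show ?thesis by (auto simp: cbox_Pair_eq)
qed

text \<open>The k-th derivative of (s (1 - s))^m. A polynomial suffices because the functions tested
  have finite order, so only finitely many derivatives must vanish at the ends.\<close>

definition bump_deriv :: "nat \<Rightarrow> nat \<Rightarrow> real \<Rightarrow> real" where
  "bump_deriv m k = poly ((pderiv ^^ k) ([:0, 1, -1:] ^ m))"

text \<open>Each differentiation removes at most one factor s (1 - s), so at least one is left when
  k < m.\<close>

lemma bump_deriv_boundary:
  assumes "k < m"
  shows "bump_deriv m k 0 = 0" "bump_deriv m k 1 = 0"
proof -
  have "k \<le> m \<Longrightarrow> [:0, 1, -1::real:] ^ (m - k) dvd (pderiv ^^ k) ([:0, 1, -1:] ^ m)" for k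
  proof (induction k)
    case (Suc k)
    define q :: "real poly" where "q = [:0, 1, -1:]"
    have mk: "m - k = Suc (m - Suc k)" using Suc.prems by simp
    obtain r where "(pderiv ^^ k) (q ^ m) = q ^ Suc (m - Suc k) * r"
      using Suc.IH Suc.prems mk unfolding q_def by (auto simp del: power_Suc elim!: dvdE)
    then have "(pderiv ^^ Suc k) (q ^ m) =
        q ^ (m - Suc k) * (q * pderiv r + r * smult (of_nat (Suc (m - Suc k))) (pderiv q))"
      by (simp add: pderiv_mult pderiv_power_Suc algebra_simps del: power_Suc)
        (simp add: algebra_simps)
    then show ?case unfolding q_def by simp
  qed simp
  from this[of k] assms obtain r where "(pderiv ^^ k) ([:0, 1, -1::real:] ^ m) = [:0, 1, -1:] ^ (m - k) * r"
    by (auto elim: dvdE)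
  then show "bump_deriv m k 0 = 0" "bump_deriv m k 1 = 0"
    using assms by (simp_all add: bump_deriv_def poly_power)
qed

lemma bump_deriv_has_derivative:
  "(bump_deriv m k has_real_derivative bump_deriv m (Suc k) s) (at s)"
  unfolding bump_deriv_def by (simp add: poly_DERIV)

text \<open>The jet at \<open>(x, y, t)\<close> of \<open>\<epsilon>\<close> times the product of \<open>(s (1 - s))\<^sup>m\<close> over the three coordinates \<open>s\<close>.\<close>

definition bump_jet :: "nat \<Rightarrow> real \<Rightarrow> real \<Rightarrow> real \<Rightarrow> real \<Rightarrow> jet" where
  "bump_jet m \<epsilon> x y t = (\<lambda>c. case c of
     Indep i \<Rightarrow> if i = 1 then x else if i = 2 then y else t
   | Deriv \<alpha> \<Rightarrow> \<epsilon> * bump_deriv m (\<alpha> $ 1) x * bump_deriv m (\<alpha> $ 2) y * bump_deriv m (\<alpha> $ 3) t)"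

lemma lagrangian_not_divergence:
  assumes F: "\<And>i. jet_C1 n (F i)"
    and div: "\<And>J. \<kappa> * lagrangian J = (\<Sum>i\<in>UNIV. total_deriv i (F i) J)"
  shows "\<kappa> = 0"
proof (rule ccontr)
  assume \<kappa>: "\<kappa> \<noteq> 0"
  \<comment> \<open>\<open>F i\<close> sees derivatives up to order \<open>n\<close>, and vanishing
    at the ends requires an order strictly below \<open>m\<close>.\<close>
  define m where "m = Suc n"
  \<comment> \<open>\<open>F i\<close> need not vanish at the jets of the zero function. Subtracting
    those values makes the boundary terms cancel, and dividing by \<kappa> makes the sum over i the
    Lagrangian itself, which is nonnegative.\<close>
  define D where "D i x y t = (total_deriv i (F i) (bump_jet m 1 x y t) - total_deriv i (F i) (bump_jet m 0 x y t)) / \<kappa>"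
    for i x y t
  have contw: "continuous_on S (bump_deriv m k)" for k S
    unfolding bump_deriv_def by (intro continuous_intros)
  have contJ: "continuous_on UNIV (\<lambda>(x, y, t). bump_jet m \<epsilon> x y t)" for \<epsilon>
  proof (rule continuous_on_coordinatewise_then_product)
    fix c
    show "continuous_on UNIV (\<lambda>z. (case z of (x, y, t) \<Rightarrow> bump_jet m \<epsilon> x y t) c)"
    proof (cases c)
      case (Indep i)
      consider "i = 1" | "i = 2" | "i = 3" using exhaust_3 by blast
      then show ?thesis
        by cases (auto simp: Indep bump_jet_def split_def intro!: continuous_intros)
    next
      case (Deriv \<alpha>)
      then show ?thesis
        by (auto simp: bump_jet_def split_def intro!: continuous_intros continuous_on_compose2[OF contw[of UNIV]])
    qed
  qed
  have cont: "continuous_on UNIV (\<lambda>(x, y, t). D i x y t)" for i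
    using continuous_on_compose2[OF continuous_total_deriv[OF F] contJ] \<kappa>
    unfolding D_def split_def by (intro continuous_intros) auto
  have axis: "axis i (1::nat) $ j = of_bool (i = j)" "axis i (Suc 0) $ j = of_bool (i = j)" for i j :: 3
    by (auto simp: axis_def)
  have int0: "integral {0..1} (\<lambda>s. (total_deriv i (F i) (\<gamma> 1 s) - total_deriv i (F i) (\<gamma> 0 s)) / \<kappa>) = 0"
    if d: "\<And>\<epsilon> s. ((\<lambda>s. F i (\<gamma> \<epsilon> s)) has_real_derivative total_deriv i (F i) (\<gamma> \<epsilon> s)) (at s)"
      and eq: "F i (\<gamma> 1 0) = F i (\<gamma> 0 0)" "F i (\<gamma> 1 1) = F i (\<gamma> 0 1)" for i \<gamma>
  proof -
    have "((\<lambda>s. (F i (\<gamma> 1 s) - F i (\<gamma> 0 s)) / \<kappa>) has_real_derivative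
        (total_deriv i (F i) (\<gamma> 1 s) - total_deriv i (F i) (\<gamma> 0 s)) / \<kappa>) (at s within {0..1})" for s
      by (rule DERIV_subset[OF DERIV_cdivide[OF DERIV_diff[OF d d]]]) simp
    then have "((\<lambda>s. (total_deriv i (F i) (\<gamma> 1 s) - total_deriv i (F i) (\<gamma> 0 s)) / \<kappa>) has_integral
        ((F i (\<gamma> 1 1) - F i (\<gamma> 0 1)) / \<kappa> - (F i (\<gamma> 1 0) - F i (\<gamma> 0 0)) / \<kappa>)) {0..1}"
      by (intro fundamental_theorem_of_calculus) (auto simp: has_real_derivative_iff_has_vector_derivative)
    with eq have "((\<lambda>s. (total_deriv i (F i) (\<gamma> 1 s) - total_deriv i (F i) (\<gamma> 0 s)) / \<kappa>) has_integral 0) {0..1}"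
      by simp
    then show ?thesis by (rule integral_unique)
  qed
  have boundary: "F i (bump_jet m 1 x y t) = F i (bump_jet m 0 x y t)"
    if "x \<in> {0, 1} \<or> y \<in> {0, 1} \<or> t \<in> {0, 1}" for i x y t
  proof -
    have "order_le n (F i)" using F by (simp add: jet_C1_def)
    moreover have "bump_jet m 1 x y t (Deriv \<alpha>) = bump_jet m 0 x y t (Deriv \<alpha>)"
      if le: "(\<Sum>i\<in>UNIV. \<alpha> $ i) \<le> n" for \<alpha>
    proof -
      have "\<alpha> $ 1 < m" "\<alpha> $ 2 < m" "\<alpha> $ 3 < m" using le by (auto simp: m_def sum_3)
      then show ?thesis
        using \<open>x \<in> {0, 1} \<or> y \<in> {0, 1} \<or> t \<in> {0, 1}\<close> bump_deriv_boundary by (auto simp: bump_jet_def)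
    qed
    moreover have "bump_jet m 1 x y t (Indep j) = bump_jet m 0 x y t (Indep j)" for j
      by (simp add: bump_jet_def)
    ultimately show ?thesis unfolding order_le_def by blast
  qed
  note chain = total_deriv_chain[OF F] and bd = bump_deriv_has_derivative
  have 1: "integral {0..1} (\<lambda>x. D 1 x y t) = 0" for y t
    unfolding D_def
  proof (rule int0)
    show "((\<lambda>x. F 1 (bump_jet m \<epsilon> x y t)) has_real_derivative total_deriv 1 (F 1) (bump_jet m \<epsilon> x y t)) (at x)"
      for \<epsilon> x
    proof (rule chain)
      show "((\<lambda>x. bump_jet m \<epsilon> x y t (Indep j)) has_real_derivative (if j = 1 then 1 else 0)) (at x)" for j
        using exhaust_3[of j] by (auto simp: bump_jet_def)
    qed (auto simp: bump_jet_def axis intro!: derivative_eq_intros bd)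
  qed (auto intro: boundary)
  have 2: "integral {0..1} (\<lambda>y. D 2 x y t) = 0" for x t
    unfolding D_def
  proof (rule int0)
    show "((\<lambda>y. F 2 (bump_jet m \<epsilon> x y t)) has_real_derivative total_deriv 2 (F 2) (bump_jet m \<epsilon> x y t)) (at y)"
      for \<epsilon> y
    proof (rule chain)
      show "((\<lambda>y. bump_jet m \<epsilon> x y t (Indep j)) has_real_derivative (if j = 2 then 1 else 0)) (at y)" for j
        using exhaust_3[of j] by (auto simp: bump_jet_def)
    qed (auto simp: bump_jet_def axis intro!: derivative_eq_intros bd)
  qed (auto intro: boundary)
  have 3: "integral {0..1} (\<lambda>t. D 3 x y t) = 0" for x y
    unfolding D_def
  proof (rule int0)
    show "((\<lambda>t. F 3 (bump_jet m \<epsilon> x y t)) has_real_derivative total_deriv 3 (F 3) (bump_jet m \<epsilon> x y t)) (at t)"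
      for \<epsilon> t
    proof (rule chain)
      show "((\<lambda>t. bump_jet m \<epsilon> x y t (Indep j)) has_real_derivative (if j = 3 then 1 else 0)) (at t)" for j
        using exhaust_3[of j] by (auto simp: bump_jet_def)
    qed (auto simp: bump_jet_def axis intro!: derivative_eq_intros bd)
  qed (auto intro: boundary)
  have L0: "lagrangian (bump_jet m 0 x y t) = 0" for x y t
    by (simp add: lagrangian_def jet_u1_def bump_jet_def)
  have sq: "lagrangian J = ((jet_u1 1 J + 2 * jet_x 2 J * jet_u1 3 J)\<^sup>2 + (jet_u1 2 J - 2 * jet_x 1 J * jet_u1 3 J)\<^sup>2) / 2" for J
    by (simp add: lagrangian_def power2_eq_square algebra_simps)
  have sum: "D 1 x y t + D 2 x y t + D 3 x y t = lagrangian (bump_jet m 1 x y t)" for x y t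
  proof -
    have "D 1 x y t + D 2 x y t + D 3 x y t =
        ((\<Sum>i\<in>UNIV. total_deriv i (F i) (bump_jet m 1 x y t)) - (\<Sum>i\<in>UNIV. total_deriv i (F i) (bump_jet m 0 x y t))) / \<kappa>"
      by (simp add: D_def sum_3 add_divide_distrib diff_divide_distrib)
    then show ?thesis using \<kappa> by (simp add: div[symmetric] L0)
  qed
  \<comment> \<open>At y = t = 1/2 the bump has u_y = u_t = 0, while u_x is nonzero at x = 1/4; the
    first square is then u_x^2.\<close>
  have L: "lagrangian (bump_jet m 1 (1/4) (1/2) (1/2)) = 0"
    unfolding sum[symmetric] by (rule divergence_cube[OF cont cont cont 1 2 3]) (auto simp: sum sq)
  have w1: "bump_deriv m 1 s = real m * (s * (1 - s)) ^ n * (1 - 2 * s)" for s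
    by (simp add: bump_deriv_def m_def pderiv_power_Suc pderiv_pCons poly_power algebra_simps del: power_Suc)
  have w0: "bump_deriv m 0 s = (s * (1 - s)) ^ m" for s
    by (simp add: bump_deriv_def poly_power algebra_simps)
  have "bump_deriv m 1 (1/2) = 0" "bump_deriv m 1 (1/4) \<noteq> 0" "bump_deriv m 0 (1/2) \<noteq> 0"
    unfolding w1 w0 by (auto simp: m_def)
  with L show False
    by (auto simp: sq jet_u1_def bump_jet_def axis sum_power2_eq_zero_iff)
qed

section \<open>Noether symmetries\<close>

lemma jet_Ck_const: "jet_Ck k (\<lambda>J. r)"
  by (induction k arbitrary: r) auto

lemma continuous_jet_point: "continuous_on UNIV jet_point"
  unfolding jet_point_def[abs_def] jet_x_def[abs_def] jet_u_def[abs_def]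
  by (intro continuous_intros) (auto intro: continuous_on_product_coordinates)

lemma jet_Ck_base: "smooth F \<Longrightarrow> jet_Ck k (\<lambda>J. F (jet_point J))"
proof (induction k arbitrary: F)
  case 0
  then show ?case
    using continuous_on_compose2[OF smooth_continuous continuous_jet_point] by auto
next
  case (Suc k)
  have "jet_Ck k (pd c (\<lambda>J. F (jet_point J)))" for c
  proof (cases c)
    case (Indep i)
    then show ?thesis using Suc by (simp add: pd_base)
  next
    case (Deriv \<alpha>)
    then show ?thesis
      using Suc by (cases "\<alpha> = 0") (simp_all add: pd_base jet_Ck_const)
  qed
  moreover have "continuous_on UNIV (\<lambda>J. F (jet_point J))"
    using continuous_on_compose2[OF smooth_continuous[OF Suc.prems] continuous_jet_point] by auto
  ultimately show ?case
    using jet_differentiable_base[OF Suc.prems] by (simp add: jet_differentiable_def)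
qed

lemma differential_function_base: "smooth F \<Longrightarrow> differential_function (\<lambda>J. F (jet_point J))"
proof -
  assume F: "smooth F"
  have "order_le 0 (\<lambda>J. F (jet_point J))"
    by (auto simp: order_le_def jet_point_def jet_x_def jet_u_def)
  then show ?thesis
    using jet_Ck_base[OF F] by (auto simp: differential_function_def)
qed

definition noether_density :: "vfield \<Rightarrow> jet \<Rightarrow> real" where
  "noether_density S J = prolong1 S lagrangian J + lagrangian J * (\<Sum>i\<in>UNIV. total_deriv i (xi S i) J)"

text \<open>With lambda the conformal factor, the contributions - 2 lambda from the horizontal
  gradient, 4 lambda from the volume and 2 \<open>cr_c\<close> = - 2 lambda from u cancel, and
  \<open>k\<close> leaves 2 k times the Lagrangian. The rest pairs the horizontal gradient of u with
  those of \<open>cr_c\<close> and \<open>b\<close>.\<close>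

lemma noether_density_cr:
  fixes J
  assumes b: "smooth b"
  defines "p \<equiv> fst (jet_point J)"
  shows "noether_density (affine_field (cr_xi a) (\<lambda>p. cr_c a p + k) b) J = 2 * k * lagrangian J
    + (jet_u1 1 J + 2 * jet_x 2 J * jet_u1 3 J) * (jet_u J * hX (cr_c a) p + hX b p)
    + (jet_u1 2 J - 2 * jet_x 1 J * jet_u1 3 J) * (jet_u J * hY (cr_c a) p + hY b p)"
proof -
  let ?X = "\<lambda>i z. cr_xi a i (fst z)" and ?E = "\<lambda>z. (cr_c a (fst z) + k) * snd z + b (fst z)"
  have X: "smooth (?X i)" and E: "smooth ?E" for i
    using b by auto
  note S = affine_field_def[of "cr_xi a" "\<lambda>p. cr_c a p + k" b]
  note eqs = xi_eq[OF X E S] eta1_eq[OF X E S]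
  obtain x y t where xyt: "jet_x 1 J = x" "jet_x 2 J = y" "jet_x 3 J = t" by blast
  show ?thesis
    unfolding noether_density_def prolong1_lagrangian eqs hX_def hY_def p_def lagrangian_def
    by (simp add: b sum_3 fst_jet_point, simp add: cr_xi_components cr_c_def fst_jet_point)
      (simp add: xyt algebra_simps power2_eq_square power3_eq_cube)
qed

text \<open>\<open>cr_potential a b i\<close> is the \<open>i\<close>-th component of $\frac12 u^2 A \nabla c + u A \nabla b$, where
  $A$ is the symbol of the Kohn-Laplace operator and \<open>c\<close> is \<open>cr_c a\<close>.\<close>

definition cr_potential :: "(nat \<Rightarrow> real) \<Rightarrow> (real^3 \<Rightarrow> real) \<Rightarrow> 3 \<Rightarrow> (real^3) \<times> real \<Rightarrow> real" where
  "cr_potential a b i = (\<lambda>z. let p = fst z; u = snd z;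
      g = u * (u / 2 * hX (cr_c a) p + hX b p); h = u * (u / 2 * hY (cr_c a) p + hY b p)
    in if i = 1 then g else if i = 2 then h else 2 * p $ 2 * g - 2 * p $ 1 * h)"

lemmas cr_potential_components = cr_potential_def[of _ _ 1, simplified Let_def]
  cr_potential_def[of _ _ 2, simplified Let_def] cr_potential_def[of _ _ 3, simplified Let_def]

lemma smooth_cr_potential:
  assumes "smooth b"
  shows "smooth (cr_potential a b i)"
  using exhaust_3[of i] assms by (auto simp: cr_potential_def Let_def)

text \<open>Besides the density, differentiating the potential produces u^2/2 times \<Delta> c and u
  times \<Delta> b. The first vanishes because \<open>cr_c a\<close> is affine in the coordinates,
  the second by harmonicity of \<open>b\<close>.\<close>

lemma cr_potential_divergence:
  assumes b: "smooth b" and harm: "\<And>p. kohn_laplace b p = 0"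
  shows "(\<Sum>i\<in>UNIV. total_deriv i (\<lambda>J. cr_potential a b i (jet_point J)) J) =
    noether_density (cr_field a b) J"
proof -
  define p where "p = fst (jet_point J)"
  have "kohn_laplace (cr_c a) p = 0"
    by (simp add: kohn_laplace_def cr_c_def)
  then have c': "partial 1 (hX (cr_c a)) p + partial 2 (hY (cr_c a)) p
      + 2 * p $ 2 * partial 3 (hX (cr_c a)) p - 2 * p $ 1 * partial 3 (hY (cr_c a)) p = 0"
    by (simp add: kohn_laplace_frame hX_def[of "hX _"] hY_def[of "hY _"])
  have b': "partial 1 (hX b) p + partial 2 (hY b) p
      + 2 * p $ 2 * partial 3 (hX b) p - 2 * p $ 1 * partial 3 (hY b) p = 0"
    using harm[of p] by (simp add: b kohn_laplace_frame hX_def[of "hX _"] hY_def[of "hY _"])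
  have x: "jet_x i J = p $ i" for i by (simp add: p_def fst_jet_point)
  have "(\<Sum>i\<in>UNIV. total_deriv i (\<lambda>J. cr_potential a b i (jet_point J)) J) =
    (jet_u1 1 J + 2 * jet_x 2 J * jet_u1 3 J) * (jet_u J * hX (cr_c a) p + hX b p)
    + (jet_u1 2 J - 2 * jet_x 1 J * jet_u1 3 J) * (jet_u J * hY (cr_c a) p + hY b p)
    + jet_u J * jet_u J / 2 * (partial 1 (hX (cr_c a)) p + partial 2 (hY (cr_c a)) p
      + 2 * p $ 2 * partial 3 (hX (cr_c a)) p - 2 * p $ 1 * partial 3 (hY (cr_c a)) p)
    + jet_u J * (partial 1 (hX b) p + partial 2 (hY b) p
      + 2 * p $ 2 * partial 3 (hX b) p - 2 * p $ 1 * partial 3 (hY b) p)"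
    unfolding sum_3 total_deriv_base[OF smooth_cr_potential[OF b]]
    by (simp add: cr_potential_components b p_def[symmetric] fst_jet_point x)
      (simp add: field_simps)
  then show ?thesis
    using noether_density_cr[OF b, of a 0 J, folded p_def] unfolding b' c' by simp
qed

lemma noether_cr_field:
  assumes "smooth b" "\<And>p. kohn_laplace b p = 0"
  shows "noether_symmetry (cr_field a b)"
proof -
  have "differential_function (\<lambda>J. cr_potential a b i (jet_point J))" for i
    by (intro differential_function_base smooth_cr_potential assms)
  then show ?thesis
    unfolding noether_symmetry_def
    using cr_point_symmetry[OF assms] cr_potential_divergence[OF assms] unfolding noether_density_def
    by (intro conjI exI[of _ "\<lambda>i J. cr_potential a b i (jet_point J)"]) auto
qed

text \<open>The field with the same \<open>a\<close> and \<open>b\<close> but k = 0 has an explicit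
  potential. Subtracting it from the given one exhibits 2 k times the Lagrangian as a
  divergence.\<close>

lemma noether_symmetry_cr_field:
  assumes "noether_symmetry S"
  obtains a b where "S = cr_field a b" "smooth b" "\<And>p. kohn_laplace b p = 0"
proof -
  obtain a k b where S: "S = affine_field (cr_xi a) (\<lambda>p. cr_c a p + k) b" and b: "smooth b"
    "\<And>p. kohn_laplace b p = 0"
    using point_symmetry_classification assms unfolding noether_symmetry_def by metis
  obtain \<phi> :: "3 \<Rightarrow> jet \<Rightarrow> real" where \<phi>: "\<And>i. differential_function (\<phi> i)"
    "\<And>J. noether_density S J = (\<Sum>i\<in>UNIV. total_deriv i (\<phi> i) J)"
    using assms unfolding noether_symmetry_def noether_density_def by blast
  define \<psi> where "\<psi> i J = cr_potential a b i (jet_point J)" for i J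
  have \<psi>: "differential_function (\<psi> i)" for i
    unfolding \<psi>_def[abs_def] by (intro differential_function_base smooth_cr_potential b)
  have ex: "\<exists>n. \<forall>m\<ge>n. jet_C1 m F" if "differential_function F" for F
    using differential_function_jet_C1[OF that] by blast
  obtain n1 where n1: "\<And>i m. n1 i \<le> m \<Longrightarrow> jet_C1 m (\<phi> i)"
    using ex[OF \<phi>(1)] by metis
  obtain n2 where n2: "\<And>i m. n2 i \<le> m \<Longrightarrow> jet_C1 m (\<psi> i)"
    using ex[OF \<psi>] by metis
  \<comment> \<open>One order that serves all six functions, so that a single bump exponent
    works.\<close>
  define n where "n = (\<Sum>i\<in>UNIV. n1 i + n2 i)"
  have "n1 i + n2 i \<le> n" for i
    unfolding n_def by (rule member_le_sum) auto
  then have C1: "jet_C1 n (\<phi> i)" "jet_C1 n (\<psi> i)" for i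
    using n1[of i n] n2[of i n] add_leE by blast+
  have "2 * k = 0"
  proof (rule lagrangian_not_divergence)
    show "jet_C1 n (\<lambda>J. \<phi> i J - \<psi> i J)" for i
      by (intro jet_C1_diff C1)
    fix J
    have "total_deriv i (\<lambda>J. \<phi> i J - \<psi> i J) J = total_deriv i (\<phi> i) J - total_deriv i (\<psi> i) J" for i
      using C1[of i] by (simp add: jet_C1_def)
    then have "(\<Sum>i\<in>UNIV. total_deriv i (\<lambda>J. \<phi> i J - \<psi> i J) J) = noether_density S J - noether_density (cr_field a b) J"
      using cr_potential_divergence[OF b, of a J] by (simp add: \<phi>(2) sum_subtractf \<psi>_def[abs_def])
    also have "\<dots> = 2 * k * lagrangian J"
      using noether_density_cr[OF b(1), of a k J] noether_density_cr[OF b(1), of a 0 J] by (simp add: S)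
    finally show "2 * k * lagrangian J = (\<Sum>i\<in>UNIV. total_deriv i (\<lambda>J. \<phi> i J - \<psi> i J) J)" by simp
  qed
  then show thesis using that S b by simp
qed

theorem theorem4:
  shows "{S. noether_symmetry S} =
    lie_generated ({vf_T, vf_R, vf_X, vf_Y, vf_V1, vf_V2, vf_V3} \<union>
      {vf_W \<beta> | \<beta>. smooth \<beta> \<and> (\<forall>p. kohn_laplace \<beta> p = 0)})"
  unfolding lie_generated_eq
  by (auto intro: noether_cr_field elim!: noether_symmetry_cr_field)

end
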